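(* If $x_0\in F$, $x_0\neq0,1,t$, and $m$ is sufficiently large, then the integral operator $H_{x_0,m}$ on $L^2(F)$ with kernel $K_{x_0,m}(y,z)$ has finite rank.
   Context: $F$ is a non-archimedean local field with residue field $\mathbb F_q$ of characteristic $p>2$, normalized absolute value $\|x\|=q^{-v(x)}$ and Haar measure $\|dx\|$. Let $t\in F$, $t\neq0,1$, and $f_t(x,y,z)=(t+xy-zx-zy)^2-4(z-t)(z-1)xy$. Let $\theta(a)=1$ if $a\in F$ is a square and $\theta(a)=0$ otherwise. For $x_0\in F$, $m\in\mathbb Z$ set $K_{x_0,m}(y,z)=2\int_{\|x-x_0\|\le q^{-m}}\frac{\theta(f_t(x,y,z))}{\sqrt{\|f_t(x,y,z)\|}}\|dx\|$, and let $H_{x_0,m}$ be the operator $(H_{x_0,m}\psi)(y)=\int_FK_{x_0,m}(y,z)\psi(z)\|dz\|$ on $L^2(F)$ (square-integrable half-densities on $\mathbb P^1(F)$ identified with functions via $\psi(z)\|dz\|^{1/2}$). This is the integral over $\|x-x_0\|\le q^{-m}$ of the modified Hecke operators for $PGL_2$ on $\mathbb P^1$ with parabolic points $0,t,1,\infty$. *)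

theory Defs
  imports "HOL-Analysis.Analysis"
begin

text \<open>A discrete valuation v on a field 'a (the value v 0 is irrelevant), with the
normalized absolute value |x| = q^(-v x) (and |0| = 0).\<close>

definition absv :: "('a::field \<Rightarrow> int) \<Rightarrow> nat \<Rightarrow> 'a \<Rightarrow> real" where
  "absv v q x = (if x = 0 then 0 else real q powr (- real_of_int (v x)))"

definition discrete_valuation :: "('a::field \<Rightarrow> int) \<Rightarrow> bool" where
  "discrete_valuation v \<longleftrightarrow>
     (\<forall>x y. x \<noteq> 0 \<longrightarrow> y \<noteq> 0 \<longrightarrow> v (x * y) = v x + v y) \<and>
     (\<forall>x y. x \<noteq> 0 \<longrightarrow> y \<noteq> 0 \<longrightarrow> x + y \<noteq> 0 \<longrightarrow> min (v x) (v y) \<le> v (x + y)) \<and>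
     (\<exists>\<pi>. \<pi> \<noteq> 0 \<and> v \<pi> = 1)"

definition val_ring :: "('a::field \<Rightarrow> int) \<Rightarrow> 'a set" where
  "val_ring v = {x. x = 0 \<or> 0 \<le> v x}"

definition val_ideal :: "('a::field \<Rightarrow> int) \<Rightarrow> 'a set" where
  "val_ideal v = {x. x = 0 \<or> 1 \<le> v x}"

definition residue_classes :: "('a::field \<Rightarrow> int) \<Rightarrow> 'a set set" where
  "residue_classes v = (\<lambda>x. {y \<in> val_ring v. x - y \<in> val_ideal v}) ` val_ring v"

definition val_complete :: "('a::field \<Rightarrow> int) \<Rightarrow> nat \<Rightarrow> bool" where
  "val_complete v q \<longleftrightarrow>
     (\<forall>X :: nat \<Rightarrow> 'a.
        (\<forall>e>0. \<exists>N. \<forall>m\<ge>N. \<forall>n\<ge>N. absv v q (X m - X n) < e) \<longrightarrow>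
        (\<exists>L. \<forall>e>0. \<exists>N. \<forall>n\<ge>N. absv v q (X n - L) < e))"

definition nonarch_local_field :: "('a::field \<Rightarrow> int) \<Rightarrow> nat \<Rightarrow> nat \<Rightarrow> bool" where
  "nonarch_local_field v q p \<longleftrightarrow>
     discrete_valuation v \<and> val_complete v q \<and>
     finite (residue_classes v) \<and> card (residue_classes v) = q \<and>
     prime p \<and> (of_nat p :: 'a) \<in> val_ideal v"

definition vball :: "('a::field \<Rightarrow> int) \<Rightarrow> nat \<Rightarrow> 'a \<Rightarrow> int \<Rightarrow> 'a set" where
  "vball v q a m = {x. absv v q (x - a) \<le> real q powr (- real_of_int m)}"

text \<open>Haar measure on F: defined on the Borel sets (generated by the balls),
translation invariant, normalized so that the ring of integers has measure 1.\<close>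
definition haar_measure :: "('a::field \<Rightarrow> int) \<Rightarrow> nat \<Rightarrow> 'a measure \<Rightarrow> bool" where
  "haar_measure v q M \<longleftrightarrow>
     space M = UNIV \<and>
     sets M = sigma_sets UNIV (range (\<lambda>(a, m). vball v q a m)) \<and>
     (\<forall>A\<in>sets M. \<forall>c. (\<lambda>x. x + c) ` A \<in> sets M \<and> emeasure M ((\<lambda>x. x + c) ` A) = emeasure M A) \<and>
     emeasure M (val_ring v) = 1"

definition is_square :: "'a::field \<Rightarrow> bool" where
  "is_square a \<longleftrightarrow> (\<exists>b. a = b * b)"

definition theta :: "'a::field \<Rightarrow> real" where
  "theta a = (if is_square a then 1 else 0)"

definition f_t :: "'a::field \<Rightarrow> 'a \<Rightarrow> 'a \<Rightarrow> 'a \<Rightarrow> 'a" where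
  "f_t t x y z = (t + x * y - z * x - z * y)^2 - 4 * (z - t) * (z - 1) * x * y"

text \<open>K_{x0,m}(y,z) = 2 \<integral>_{|x-x0| \<le> q^-m} theta(f)/sqrt|f| dx (nonnegative integral;
converted to a real number, the value on the null set where it is infinite is irrelevant).\<close>
definition kernelK :: "('a::field \<Rightarrow> int) \<Rightarrow> nat \<Rightarrow> 'a measure \<Rightarrow> 'a \<Rightarrow> 'a \<Rightarrow> int \<Rightarrow> 'a \<Rightarrow> 'a \<Rightarrow> real" where
  "kernelK v q M t x0 m y z =
     2 * enn2real (\<integral>\<^sup>+ x. indicator (vball v q x0 m) x *
        ennreal (theta (f_t t x y z) / sqrt (absv v q (f_t t x y z))) \<partial>M)"

definition hecke_op :: "('a::field \<Rightarrow> int) \<Rightarrow> nat \<Rightarrow> 'a measure \<Rightarrow> 'a \<Rightarrow> 'a \<Rightarrow> int \<Rightarrow> ('a \<Rightarrow> complex) \<Rightarrow> 'a \<Rightarrow> complex" where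
  "hecke_op v q M t x0 m \<psi> y = (\<integral> z. complex_of_real (kernelK v q M t x0 m y z) * \<psi> z \<partial>M)"

definition square_integrable :: "'a measure \<Rightarrow> ('a \<Rightarrow> complex) \<Rightarrow> bool" where
  "square_integrable M g \<longleftrightarrow> g \<in> borel_measurable M \<and> integrable M (\<lambda>x. (cmod (g x))^2)"

definition finite_rank_integral_op :: "'a measure \<Rightarrow> ('a \<Rightarrow> 'a \<Rightarrow> real) \<Rightarrow> bool" where
  "finite_rank_integral_op M K \<longleftrightarrow>
     (\<exists>G :: ('a \<Rightarrow> complex) set. finite G \<and> (\<forall>g\<in>G. square_integrable M g) \<and>
        (\<forall>\<psi>. square_integrable M \<psi> \<longrightarrow>
           (AE y in M. integrable M (\<lambda>z. complex_of_real (K y z) * \<psi> z)) \<and>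
           (\<exists>c :: ('a \<Rightarrow> complex) \<Rightarrow> complex.
              AE y in M. (\<integral> z. complex_of_real (K y z) * \<psi> z \<partial>M) = (\<Sum>g\<in>G. c g * g y))))"

end

theory Submission
  imports Defs
begin

text \<open>
The polynomial \<open>f_t\<close> is quadratic in \<open>x\<close> with leading coefficient \<open>(y - z)\<^sup>2\<close>, a square, and with
discriminant \<open>16 e(y) e(z)\<close>, where \<open>e(y) = y (y - 1) (y - t)\<close>. Completing the square therefore turns the
kernel into an integral of \<open>\<theta>(U\<^sup>2 - D) / \<parallel>U\<^sup>2 - D\<parallel>\<^sup>1\<^sup>/\<^sup>2\<close> over a ball, \<open>D\<close> being the discriminant. Multiplying
\<open>D\<close> by the square of a unit can be undone by rescaling \<open>U\<close>, so the kernel is locally constant where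
\<open>D \<noteq> 0\<close>; the symmetry \<open>y \<mapsto> t / y\<close> gives the same picture at infinity. If the ball around \<open>x0\<close> avoids \<open>0, 1, t\<close>,
then at a point where \<open>D = 0\<close> and the kernel is singular only one of \<open>e(y)\<close>, \<open>e(z)\<close> vanishes, and nearby the
kernel is a function of that single variable, of growth at most \<open>\<parallel>e\<parallel>\<^sup>-\<^sup>1\<^sup>/\<^sup>4\<close>, hence square integrable. By
compactness of the product of two projective lines the kernel is a finite sum of products \<open>g(y) h(z)\<close>
of square integrable functions.
\<close>

section \<open>Valuation and square classes\<close>

text \<open>The rank is finite, and not merely the operator compact, because the local statements
  are exact equalities: for odd residue characteristic an element close to
  \<open>D \<noteq> 0\<close> is \<open>r^2 * D\<close> with \<open>r\<close> a unit close to 1, and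
  the weight obeys \<open>w (r^2 * u) = w u / nrm r\<close>. Completing the square needs a factor 4
  times the leading coefficient; it preserves square classes only because that coefficient is itself
  a square. Two places resist. On the diagonal \<open>y = z\<close> the leading coefficient
  vanishes; the linear one is then \<open>-4 * cubic t y\<close>, so either the single root that
  stays bounded is followed, or the polynomial reduces to a nonzero constant. When both variables
  are parabolic points, the discriminant vanishes in both at once; there the polynomial in
  \<open>x\<close> is the square of one of degree at most 1, whose root, if any, is 0, 1 or
  \<open>t\<close>. A ball around \<open>x0\<close> that avoids these points removes this case, and
  this is the only use made of \<open>m\<close> being large.\<close>

definition vid :: "('a::field \<Rightarrow> int) \<Rightarrow> int \<Rightarrow> 'a set" where
  "vid v k = {x. x = 0 \<or> k \<le> v x}"

text \<open>The integrand of the kernel as a function of the value of \<open>f_t\<close>. Division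
  by zero gives \<open>wt v q 0 = 0\<close>, so no case distinction is needed at roots.\<close>

definition wt :: "('a::field \<Rightarrow> int) \<Rightarrow> nat \<Rightarrow> 'a \<Rightarrow> real" where
  "wt v q u = theta u / sqrt (absv v q u)"

locale local_field_haar =
  fixes v :: "'a::field \<Rightarrow> int" and q p :: nat and M :: "'a measure"
  assumes local_field: "nonarch_local_field v q p"
    and p_gt_2: "p > 2"
    and haar: "haar_measure v q M"
begin

abbreviation P :: "int \<Rightarrow> 'a set" where "P \<equiv> vid v"
abbreviation nrm :: "'a \<Rightarrow> real" where "nrm \<equiv> absv v q"
abbreviation w :: "'a \<Rightarrow> real" where "w \<equiv> wt v q"

lemma dval: "discrete_valuation v"
  using local_field by (simp add: nonarch_local_field_def)

lemma v_mult: "x \<noteq> 0 \<Longrightarrow> y \<noteq> 0 \<Longrightarrow> v (x * y) = v x + v y"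
  using dval unfolding discrete_valuation_def by blast

lemma v_add: "x \<noteq> 0 \<Longrightarrow> y \<noteq> 0 \<Longrightarrow> x + y \<noteq> 0 \<Longrightarrow> min (v x) (v y) \<le> v (x + y)"
  using dval unfolding discrete_valuation_def by blast

lemma v_1 [simp]: "v 1 = 0"
  using v_mult[of 1 1] by simp

lemma v_minus [simp]: "v (- x) = v x"
proof (cases "x = 0")
  case False
  have "v (-1) = 0" using v_mult[of "-1" "-1"] by simp
  then show ?thesis using v_mult[of "-1" x] False by simp
qed simp

lemma v_inverse: "x \<noteq> 0 \<Longrightarrow> v (inverse x) = - v x"
  using v_mult[of x "inverse x"] by simp

lemma v_divide: "x \<noteq> 0 \<Longrightarrow> y \<noteq> 0 \<Longrightarrow> v (x / y) = v x - v y"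
  using v_mult[of x "inverse y"] v_inverse[of y] by (simp add: divide_inverse)

lemma P_0 [simp]: "0 \<in> P k"
  by (simp add: vid_def)

lemma P_add: "x \<in> P k \<Longrightarrow> y \<in> P k \<Longrightarrow> x + y \<in> P k"
  unfolding vid_def using v_add[of x y] by fastforce

lemma P_minus [simp]: "- x \<in> P k \<longleftrightarrow> x \<in> P k"
  by (auto simp: vid_def)

lemma P_diff: "x \<in> P k \<Longrightarrow> y \<in> P k \<Longrightarrow> x - y \<in> P k"
  using P_add[of x k "- y"] by simp

lemma P_diff_commute: "x - y \<in> P k \<longleftrightarrow> y - x \<in> P k"
  using P_minus[of "x - y" k] by simp

lemma P_mult: "x \<in> P j \<Longrightarrow> y \<in> P k \<Longrightarrow> x * y \<in> P (j + k)"
  unfolding vid_def using v_mult[of x y] by fastforce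

lemma P_mono: "j \<le> k \<Longrightarrow> x \<in> P k \<Longrightarrow> x \<in> P j"
  by (auto simp: vid_def)

lemma P_self [simp]: "x \<in> P (v x)"
  by (auto simp: vid_def)

lemma P_mult_iff: "a \<noteq> 0 \<Longrightarrow> a * x \<in> P (v a + k) \<longleftrightarrow> x \<in> P k"
  by (cases "x = 0") (auto simp: vid_def v_mult)

lemma P_mult_iff': "a \<noteq> 0 \<Longrightarrow> a * x \<in> P k \<longleftrightarrow> x \<in> P (k - v a)"
  using P_mult_iff[of a x "k - v a"] by simp

lemma P_all_zero:
  assumes "\<And>k::nat. x \<in> P (int k)"
  shows "x = 0"
proof (rule ccontr)
  assume "x \<noteq> 0"
  then have "int k \<le> v x" for k using assms[of k] by (simp add: vid_def)
  from this[of "nat (v x + 1)"] show False by linarith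
qed

lemma v_add_eq:
  assumes "x \<noteq> 0" "y \<in> P (v x + 1)"
  shows "x + y \<noteq> 0" "v (x + y) = v x"
proof -
  show nz: "x + y \<noteq> 0"
  proof
    assume "x + y = 0"
    then have "y = - x" by (simp add: eq_neg_iff_add_eq_0 add.commute)
    then show False using assms by (auto simp: vid_def)
  qed
  show "v (x + y) = v x"
  proof (cases "y = 0")
    case False
    then have y: "v y \<ge> v x + 1" using assms by (auto simp: vid_def)
    have 1: "min (v x) (v y) \<le> v (x + y)" using v_add assms False nz by blast
    have "min (v (x + y)) (v (- y)) \<le> v ((x + y) + (- y))"
      using v_add[of "x + y" "- y"] nz False assms by simp
    then show ?thesis using 1 y by auto
  qed simp
qed

lemma P_add_iff: "y \<in> P k \<Longrightarrow> x + y \<in> P k \<longleftrightarrow> x \<in> P k"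
  using P_diff[of "x + y" k y] P_add[of x k y] by auto

lemma P_of_nat: "of_nat n \<in> P 0"
proof (induction n)
  case (Suc n)
  have "(1::'a) \<in> P 0" by (simp add: vid_def)
  then show ?case using P_add[OF _ Suc] by simp
qed simp

text \<open>Write \<open>p = 2 * k + 1\<close>: if 2 were in the maximal ideal, so would be
  \<open>1 = p - 2 * k\<close>. Thus 2 is a unit, which every square root below relies on.\<close>

lemma two_nz: "(2::'a) \<noteq> 0" and v_2: "v 2 = 0"
proof -
  have p: "prime p" "(of_nat p :: 'a) \<in> P 1"
    using local_field by (auto simp: nonarch_local_field_def val_ideal_def vid_def)
  have "odd p" using p p_gt_2 prime_odd_nat by auto
  then obtain k where k: "p = 2 * k + 1" by (auto elim: oddE)
  have "(2::'a) \<notin> P 1"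
  proof
    assume "(2::'a) \<in> P 1"
    then have "2 * of_nat k \<in> P (1 + 0)" using P_of_nat P_mult by blast
    then have "of_nat p - 2 * of_nat k \<in> P 1" using p P_diff by simp
    then have "(1::'a) \<in> P 1" using k by simp
    then show False by (simp add: vid_def)
  qed
  moreover have "(2::'a) \<in> P 0" using P_of_nat[of 2] by simp
  ultimately show "(2::'a) \<noteq> 0" "v 2 = 0" by (auto simp: vid_def)
qed

lemma q_gt_1: "q > 1"
proof -
  let ?c = "\<lambda>x. {y \<in> val_ring v. x - y \<in> val_ideal v}"
  have 0: "0 \<in> val_ring v" and 1: "1 \<in> val_ring v" by (auto simp: val_ring_def)
  have "(0::'a) \<in> ?c 0" using 0 by (auto simp: val_ideal_def)
  moreover have "(0::'a) \<notin> ?c 1" by (auto simp: val_ideal_def)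
  ultimately have ne: "?c 0 \<noteq> ?c 1" by blast
  have sub: "{?c 0, ?c 1} \<subseteq> residue_classes v" using imageI[OF 0, of ?c] imageI[OF 1, of ?c] unfolding residue_classes_def by simp
  have "card {?c 0, ?c 1} = 2" using ne by simp
  moreover have "card {?c 0, ?c 1} \<le> q"
    using card_mono[OF _ sub] local_field by (simp add: nonarch_local_field_def)
  ultimately show ?thesis by simp
qed

lemma nrm_0 [simp]: "nrm 0 = 0"
  by (simp add: absv_def)

lemma nrm_pos: "x \<noteq> 0 \<Longrightarrow> nrm x > 0"
  using q_gt_1 by (simp add: absv_def)

lemma nrm_nonneg [simp]: "nrm x \<ge> 0"
  using q_gt_1 by (simp add: absv_def)

lemma nrm_eq_0 [simp]: "nrm x = 0 \<longleftrightarrow> x = 0"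
  by (metis nrm_0 nrm_pos less_irrefl)

lemma nrm_mult: "nrm (x * y) = nrm x * nrm y"
  using v_mult[of x y] by (auto simp: absv_def powr_add[symmetric])

lemma nrm_divide: "nrm (x / y) = nrm x / nrm y"
proof (cases "y = 0")
  case False
  have "nrm x = nrm (x / y) * nrm y" using nrm_mult[of "x / y" y] False by simp
  then show ?thesis using nrm_pos[OF False] by (simp add: field_simps)
qed simp

lemma nrm_power2: "nrm (x^2) = (nrm x)^2"
  by (simp add: power2_eq_square nrm_mult)

lemma nrm_eq: "x \<noteq> 0 \<Longrightarrow> y \<noteq> 0 \<Longrightarrow> v x = v y \<Longrightarrow> nrm x = nrm y"
  by (simp add: absv_def)

lemma nrm_le_iff: "nrm x \<le> real q powr (- real_of_int k) \<longleftrightarrow> x \<in> P k"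
  using q_gt_1 by (auto simp: absv_def vid_def powr_le_cancel_iff)

lemma nrm_less_iff: "nrm x < real q powr (- real_of_int k) \<longleftrightarrow> x \<in> P (k + 1)"
  using q_gt_1 by (auto simp: absv_def vid_def powr_less_cancel_iff)

lemma vball_eq: "vball v q a m = {x. x - a \<in> P m}"
  by (simp add: vball_def nrm_le_iff)

lemma complete:
  assumes "\<And>n. X (Suc n) - X n \<in> P (k + int n)"
  obtains L where "\<And>n. L - X n \<in> P (k + int n)"
proof -
  have step: "X (n + j) - X n \<in> P (k + int n)" for n j
  proof (induction j)
    case (Suc j)
    have "X (Suc (n + j)) - X (n + j) \<in> P (k + int n)"
      by (rule P_mono[OF _ assms]) simp
    from P_add[OF this Suc] show ?case by simp
  qed simp
  have small: "\<exists>N::nat. real q powr (- real_of_int (k + int N)) < e" if "e > 0" for e :: real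
  proof -
    have "0 < e * real q powr k" "1 / real q < 1" using that q_gt_1 by auto
    then obtain N where N: "(1 / real q)^N < e * real q powr k"
      using real_arch_pow_inv by blast
    have "real q powr (- real_of_int (k + int N)) = real q powr (- k) * real q powr (- real N)"
      by (simp flip: powr_add)
    also have "real q powr (- real N) = (1 / real q)^N"
      using q_gt_1 by (simp add: powr_minus powr_realpow power_one_over inverse_eq_divide)
    finally have "real q powr (- real_of_int (k + int N)) = real q powr (- k) * (1 / real q)^N" .
    also have "real q powr (- k) * (1 / real q)^N < real q powr (- k) * (e * real q powr k)"
      using N q_gt_1 by (intro mult_strict_left_mono) auto
    also have "\<dots> = e" using q_gt_1 by (simp add: powr_minus)
    finally show ?thesis by blast
  qed
  have "\<forall>e>0. \<exists>N. \<forall>m\<ge>N. \<forall>n\<ge>N. nrm (X m - X n) < e"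
  proof (intro allI impI)
    fix e :: real assume "e > 0"
    then obtain N where N: "real q powr (- real_of_int (k + int N)) < e" using small by blast
    have "nrm (X m - X n) < e" if "m \<ge> N" "n \<ge> N" for m n
    proof -
      have "X m - X N \<in> P (k + int N)" "X n - X N \<in> P (k + int N)"
        using step[of N "m - N"] step[of N "n - N"] that by simp_all
      from P_diff[OF this] have "X m - X n \<in> P (k + int N)" by simp
      then show ?thesis using N nrm_le_iff by (meson le_less_trans)
    qed
    then show "\<exists>N. \<forall>m\<ge>N. \<forall>n\<ge>N. nrm (X m - X n) < e" by blast
  qed
  moreover have "val_complete v q" using local_field by (simp add: nonarch_local_field_def)
  ultimately obtain L where L: "\<forall>e>0. \<exists>N. \<forall>n\<ge>N. nrm (X n - L) < e"
    unfolding val_complete_def by blast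
  have "L - X n \<in> P (k + int n)" for n
  proof -
    have "real q powr (- real_of_int (k + int n)) > 0" using q_gt_1 by simp
    then obtain N where N: "\<forall>j\<ge>N. nrm (X j - L) < real q powr (- real_of_int (k + int n))"
      using L by blast
    have "X (n + N) - L \<in> P (k + int n)"
      using N nrm_le_iff by (meson le_add2 less_imp_le)
    from P_diff[OF step[of n N] this] show ?thesis by simp
  qed
  then show thesis by (rule that)
qed

text \<open>The square root is \<open>1 + s\<close> with \<open>s\<close> the fixed point of the contraction
  \<open>s \<mapsto> (d - s\<^sup>2) / 2\<close>.\<close>
lemma hensel_sqrt:
  assumes "d \<in> P k" "k \<ge> 1"
  obtains s where "s \<in> P k" "(1 + s)^2 = 1 + d"
proof -
  define T where "T s = (d - s^2) / 2" for s :: 'a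
  define X where "X n = (T ^^ n) 0" for n
  have half: "x / 2 \<in> P j \<longleftrightarrow> x \<in> P j" for x j
    using P_mult_iff'[OF two_nz, of "x / 2" j] v_2 two_nz by simp
  have Tk: "T s \<in> P k" if "s \<in> P k" for s
  proof -
    have "s^2 \<in> P k" using P_mono[OF _ P_mult[OF that that]] assms by (simp add: power2_eq_square)
    then show ?thesis using assms by (simp add: T_def half P_diff)
  qed
  have Xk: "X n \<in> P k" for n by (induction n) (auto simp: X_def Tk)
  \<comment> \<open>The difference is \<open>-(s - s') * (s + s') / 2\<close>, and the factor
    \<open>s + s'\<close> lies in \<open>P k\<close> with \<open>k \<ge> 1\<close>; this gains one
    power.\<close>
  have contr: "T s - T s' \<in> P (j + 1)" if "s \<in> P k" "s' \<in> P k" "s - s' \<in> P j" for s s' j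
  proof -
    have "T s - T s' = - ((s - s') * (s + s') / 2)"
      by (simp add: T_def power2_eq_square diff_divide_distrib[symmetric] minus_divide_left algebra_simps)
    moreover have "(s - s') * (s + s') \<in> P (j + k)" using that by (intro P_mult P_add)
    then have "(s - s') * (s + s') \<in> P (j + 1)" by (rule P_mono[rotated]) (use assms in simp)
    ultimately show ?thesis by (simp add: half)
  qed
  have "X (Suc n) - X n \<in> P (k + int n)" for n
  proof (induction n)
    case 0
    show ?case using Xk[of 1] Xk[of 0] P_diff by simp
  next
    case (Suc n)
    have "T (X (Suc n)) - T (X n) \<in> P ((k + int n) + 1)" by (rule contr) (use Xk Suc in auto)
    then show ?case by (simp add: X_def add_ac)
  qed
  then obtain s where s: "\<And>n. s - X n \<in> P (k + int n)" using complete by blast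
  have sk: "s \<in> P k" using s[of 0] P_add[OF _ Xk[of 0]] by fastforce
  have "s - T s = 0"
  proof (rule P_all_zero)
    fix n :: nat
    have "s - X (Suc n) \<in> P (int n)" using P_mono[OF _ s[of "Suc n"]] assms by simp
    moreover have "T s - T (X n) \<in> P (int n)"
      using P_mono[OF _ contr[OF sk Xk s[of n]]] assms by simp
    ultimately show "s - T s \<in> P (int n)"
      using P_diff by (fastforce simp: X_def)
  qed
  then have "2 * s = d - s^2" unfolding T_def using two_nz by (simp add: field_simps)
  then have "(1 + s)^2 = 1 + d" by (simp add: power2_eq_square algebra_simps)
  with sk show thesis by (rule that)
qed

text \<open>The quotient \<open>y / x\<close> is 1 plus an element of \<open>P k\<close>, so it has
  a square root in \<open>1 + P k\<close>. All local constancy below rests on this; the precision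
  \<open>k\<close> of \<open>r\<close> is kept because a centre gets multiplied by \<open>r\<close>
  later.\<close>

lemma near_is_square_multiple:
  assumes "x \<noteq> 0" "y - x \<in> P (v x + k)" "k \<ge> 1"
  obtains r where "r - 1 \<in> P k" "r \<noteq> 0" "v r = 0" "nrm r = 1" "y = r^2 * x"
proof -
  have "(y - x) / x \<in> P k" using P_mult_iff[of x "(y - x) / x" k] assms by simp
  then obtain s where s: "s \<in> P k" "(1 + s)^2 = 1 + (y - x) / x"
    using hensel_sqrt assms(3) by blast
  have y: "y = (1 + s)^2 * x" using s assms by (simp add: field_simps)
  have "s \<in> P (v 1 + 1)" using P_mono[OF _ s(1), of 1] assms by simp
  from v_add_eq[OF _ this] have r: "1 + s \<noteq> 0" "v (1 + s) = 0" by auto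
  then have "nrm (1 + s) = 1" using nrm_eq[of "1 + s" 1] q_gt_1 by (simp add: absv_def)
  then show thesis using that[of "1 + s"] s(1) y r by simp
qed

lemma is_square_mult: "r \<noteq> 0 \<Longrightarrow> is_square (r^2 * u) \<longleftrightarrow> is_square u"
proof
  assume r: "r \<noteq> 0"
  { assume "is_square (r^2 * u)"
    then obtain b where b: "r^2 * u = b * b" by (auto simp: is_square_def)
    have "u = (b / r) * (b / r)" using b r by (simp add: power2_eq_square field_simps)
    then show "is_square u" unfolding is_square_def by blast }
  { assume "is_square u"
    then obtain b where b: "u = b * b" by (auto simp: is_square_def)
    have "r^2 * u = (r * b) * (r * b)" using b by (simp add: power2_eq_square)
    then show "is_square (r^2 * u)" unfolding is_square_def by blast }
qed

lemma w_mult: "r \<noteq> 0 \<Longrightarrow> w (r^2 * u) = w u / nrm r"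
  using nrm_pos[of r]
  by (simp add: wt_def theta_def is_square_mult nrm_mult nrm_power2 real_sqrt_mult)

lemma w_nonneg [simp]: "w u \<ge> 0"
  by (simp add: wt_def theta_def)

lemma w_le: "w u \<le> nrm u powr (- 1/2)"
proof (cases "u = 0")
  case False
  then show ?thesis using nrm_pos[OF False]
    by (simp add: wt_def theta_def powr_minus powr_half_sqrt divide_simps)
qed (simp add: wt_def)

lemma w_near: "x \<noteq> 0 \<Longrightarrow> y - x \<in> P (v x + 1) \<Longrightarrow> w y = w x"
  by (rule near_is_square_multiple[of x y 1]) (simp_all add: w_mult)

lemma w_square: "r \<noteq> 0 \<Longrightarrow> w (r^2) = 1 / nrm r"
proof -
  have "is_square (1::'a)" by (auto simp: is_square_def intro: exI[of _ 1])
  then have "w 1 = 1" using q_gt_1 by (simp add: wt_def theta_def absv_def)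
  then show "r \<noteq> 0 \<Longrightarrow> w (r^2) = 1 / nrm r" using w_mult[of r 1] by simp
qed

section \<open>Haar measure\<close>

abbreviation B :: "'a \<Rightarrow> int \<Rightarrow> 'a set" where "B a k \<equiv> {x. x - a \<in> P k}"

lemma P_max [simp]: "x \<in> P (max j k) \<longleftrightarrow> x \<in> P j \<and> x \<in> P k"
  by (auto simp: vid_def)

lemma ex_val: "\<exists>a. a \<noteq> 0 \<and> v a = k"
proof -
  obtain \<pi> where pi: "\<pi> \<noteq> 0" "v \<pi> = 1" using dval by (auto simp: discrete_valuation_def)
  have pow: "v (\<pi> ^ n) = int n" for n by (induction n) (auto simp: v_mult pi)
  show ?thesis
  proof (cases "k \<ge> 0")
    case True
    then show ?thesis using pow[of "nat k"] pi by (intro exI[of _ "\<pi> ^ nat k"]) simp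
  next
    case False
    then show ?thesis using pow[of "nat (- k)"] v_inverse[of "\<pi> ^ nat (- k)"] pi
      by (intro exI[of _ "inverse (\<pi> ^ nat (- k))"]) simp
  qed
qed

lemma residue_reps:
  obtains R where "finite R" "card R = q" "R \<subseteq> P 0"
    "\<And>x. x \<in> P 0 \<Longrightarrow> \<exists>r\<in>R. x - r \<in> P 1" "\<And>r r'. r \<in> R \<Longrightarrow> r' \<in> R \<Longrightarrow> r - r' \<in> P 1 \<Longrightarrow> r = r'"
proof -
  define f where "f = (\<lambda>x. {y \<in> val_ring v. x - y \<in> val_ideal v})"
  have O: "val_ring v = P 0" and I: "val_ideal v = P 1"
    by (auto simp: val_ring_def val_ideal_def vid_def)
  have rc: "residue_classes v = f ` P 0" by (simp add: residue_classes_def f_def O)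
  define g where "g = inv_into (P 0) f"
  define R where "R = g ` residue_classes v"
  have inj: "inj_on g (residue_classes v)" unfolding g_def rc by (simp add: inj_on_inv_into)
  have fg: "f (g c) = c" if "c \<in> residue_classes v" for c
    using that by (simp add: g_def rc f_inv_into_f)
  have gO: "g c \<in> P 0" if "c \<in> residue_classes v" for c
    using that by (simp add: g_def rc inv_into_into)
  have fin: "finite (residue_classes v)" "card (residue_classes v) = q"
    using local_field by (auto simp: nonarch_local_field_def)
  show thesis
  proof
    show "finite R" using fin by (simp add: R_def)
    show "card R = q" using fin inj by (simp add: R_def card_image)
    show "R \<subseteq> P 0" using gO by (auto simp: R_def)
    show "\<exists>r\<in>R. x - r \<in> P 1" if x: "x \<in> P 0" for x
    proof -
      have c: "f x \<in> residue_classes v" using x by (simp add: rc)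
      have "x \<in> f x" using x by (simp add: f_def O I)
      then have "x \<in> f (g (f x))" using fg[OF c] by simp
      then have "g (f x) - x \<in> P 1" by (simp add: f_def I)
      then show ?thesis using c P_diff_commute by (auto simp: R_def)
    qed
    show "r = r'" if rr: "r \<in> R" "r' \<in> R" "r - r' \<in> P 1" for r r'
    proof -
      have "f r = f r'"
      proof -
        have "r - y \<in> P 1 \<longleftrightarrow> r' - y \<in> P 1" for y
          using P_add_iff[OF rr(3), of "r' - y"] by (simp add: algebra_simps)
        then show ?thesis by (simp add: f_def I)
      qed
      then show ?thesis using rr fg by (auto simp: R_def)
    qed
  qed
qed

text \<open>Residue representatives, scaled by an element of valuation \<open>k\<close>, serve as
  new centres. The disjointness is for the measure of balls, the covering also for
  compactness.\<close>

lemma ball_split: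
  obtains R where "finite R" "card R = q"
    "\<And>a. B a k = (\<Union>r\<in>R. B (a + r) (k + 1))" "\<And>a. disjoint_family_on (\<lambda>r. B (a + r) (k + 1)) R"
proof -
  obtain R where R: "finite R" "card R = q" "R \<subseteq> P 0"
    "\<And>x. x \<in> P 0 \<Longrightarrow> \<exists>r\<in>R. x - r \<in> P 1"
    "\<And>r r'. r \<in> R \<Longrightarrow> r' \<in> R \<Longrightarrow> r - r' \<in> P 1 \<Longrightarrow> r = r'"
    using residue_reps by blast
  obtain c where c: "c \<noteq> 0" "v c = k" using ex_val by blast
  let ?R = "(\<lambda>r. c * r) ` R"
  show thesis
  proof (rule that[of ?R])
    show "finite ?R" using R by simp
    show "card ?R = q" using R c by (simp add: card_image inj_on_def)
    show "B a k = (\<Union>r\<in>?R. B (a + r) (k + 1))" for a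
    proof safe
      fix x assume x: "x - a \<in> P k"
      then have "(x - a) / c \<in> P 0" using P_mult_iff[OF c(1), of "(x - a) / c" 0] c by simp
      then obtain r where r: "r \<in> R" "(x - a) / c - r \<in> P 1" using R by blast
      have "c * ((x - a) / c - r) \<in> P (k + 1)" using r(2) P_mult_iff[OF c(1)] c by blast
      moreover have "c * ((x - a) / c - r) = x - (a + c * r)" using c by (simp add: field_simps)
      ultimately have "x - (a + c * r) \<in> P (k + 1)" by simp
      then show "x \<in> (\<Union>r\<in>?R. B (a + r) (k + 1))" using r by blast
    next
      fix x r assume r: "r \<in> R" and x: "x - (a + c * r) \<in> P (k + 1)"
      have "c * r \<in> P k" using P_mult_iff[OF c(1), of r 0] c r R by auto
      then show "x - a \<in> P k" using P_add[OF P_mono[OF _ x, of k]] by fastforce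
    qed
    show "disjoint_family_on (\<lambda>r. B (a + r) (k + 1)) ?R" for a
      unfolding disjoint_family_on_def
    proof safe
      fix r r' x assume r: "r \<in> R" "r' \<in> R" "c * r \<noteq> c * r'"
        and x: "x - (a + c * r) \<in> P (k + 1)" "x - (a + c * r') \<in> P (k + 1)"
      have "c * (r' - r) \<in> P (k + 1)" using P_diff[OF x] by (simp add: algebra_simps)
      then have "r' - r \<in> P 1" using P_mult_iff[OF c(1)] c by blast
      then show "x \<in> {}" using R(5)[of r' r] r by auto
    qed
  qed
qed

lemma ball_eq: "x \<in> B a k \<Longrightarrow> B x k = B a k"
proof -
  assume x: "x \<in> B a k"
  have "y - x \<in> P k \<longleftrightarrow> y - a \<in> P k" for y
    using P_add_iff[of "x - a" k "y - x"] x by simp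
  then show ?thesis by simp
qed

text \<open>For fixed \<open>j\<close> and \<open>k\<close> only finitely many balls of level
  \<open>k\<close> have their centre in \<open>P j\<close>, and the sets \<open>P j\<close> exhaust
  the field. This is what puts open sets into the sigma-algebra generated by balls.\<close>

lemma countable_balls: "countable (range (\<lambda>(a, k). B a k))"
proof -
  have fin: "finite ((\<lambda>a. B a (j + int n)) ` P j)" for j n
  proof (induction n)
    case 0
    have "B a j = P j" if "a \<in> P j" for a using ball_eq[of a 0 j] that by simp
    then have "(\<lambda>a. B a (j + int 0)) ` P j \<subseteq> {P j}" by auto
    then show ?case by (rule finite_subset) simp
  next
    case (Suc n)
    let ?k = "j + int n"
    obtain R where R: "finite R" "\<And>a. B a ?k = (\<Union>r\<in>R. B (a + r) (?k + 1))"
      using ball_split[of ?k] by metis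
    \<comment> \<open>A ball of the next level is recovered from the enclosing ball, with a centre
      fixed by choice, and one of finitely many residues.\<close>
    let ?f = "\<lambda>(S, r). B ((SOME a. a \<in> P j \<and> S = B a ?k) + r) (?k + 1)"
    have "(\<lambda>a. B a (?k + 1)) ` P j \<subseteq> ?f ` (((\<lambda>a. B a ?k) ` P j) \<times> R)"
    proof safe
      fix a assume a: "a \<in> P j"
      define b where "b = (SOME b. b \<in> P j \<and> B a ?k = B b ?k)"
      have "b \<in> P j \<and> B a ?k = B b ?k" unfolding b_def by (rule someI[of _ a]) (use a in simp)
      then have "a \<in> B b ?k" by auto
      then obtain r where r: "r \<in> R" "a \<in> B (b + r) (?k + 1)" using R(2)[of b] by blast
      from ball_eq[OF r(2)] have e: "B a (?k + 1) = ?f (B a ?k, r)" by (simp add: b_def)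
      show "B a (?k + 1) \<in> ?f ` (((\<lambda>a. B a ?k) ` P j) \<times> R)"
        by (rule image_eqI[where f = ?f, OF e]) (use r a in auto)
    qed
    then have "finite ((\<lambda>a. B a (?k + 1)) ` P j)"
      by (rule finite_subset) (use Suc R in auto)
    then show ?case by (simp add: add_ac)
  qed
  have fin': "finite ((\<lambda>a. B a k) ` P j)" for j k
  proof (cases "j \<le> k")
    case True
    then show ?thesis using fin[of j "nat (k - j)"] by simp
  next
    case False
    then have "(\<lambda>a. B a k) ` P j \<subseteq> (\<lambda>a. B a k) ` P k" using P_mono[of k j] by auto
    then show ?thesis by (rule finite_subset) (use fin[of k 0] in simp)
  qed
  have "range (\<lambda>(a, k). B a k) \<subseteq> (\<Union>k::int. \<Union>j::int. (\<lambda>a. B a k) ` P j)"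
  proof safe
    fix a k
    have "a \<in> P (v a)" by simp
    then show "B a k \<in> (\<Union>k::int. \<Union>j::int. (\<lambda>a. B a k) ` P j)" by blast
  qed
  then show ?thesis
    by (rule countable_subset) (intro countable_UN countable_finite fin' countableI_type)
qed

lemma space_M [simp]: "space M = UNIV"
  using haar by (simp add: haar_measure_def)

lemma sets_M: "sets M = sigma_sets UNIV (range (\<lambda>(a, k). B a k))"
  using haar by (simp add: haar_measure_def vball_eq)

lemma ball_sets [measurable, simp]: "B a k \<in> sets M"
  unfolding sets_M by (intro sigma_sets.Basic) auto

lemma P_sets [measurable, simp]: "P k \<in> sets M"
  using ball_sets[of 0 k] by simp

lemma open_sets:
  assumes "\<And>x. x \<in> T \<Longrightarrow> \<exists>k. B x k \<subseteq> T"
  shows "T \<in> sets M"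
proof -
  let ?C = "{S \<in> range (\<lambda>(a, k). B a k). S \<subseteq> T}"
  have "T = \<Union> ?C"
  proof safe
    fix x assume "x \<in> T"
    then obtain k where "B x k \<subseteq> T" using assms by blast
    moreover have "x \<in> B x k" by simp
    ultimately show "x \<in> \<Union> ?C" by blast
  qed blast
  moreover have "countable ?C" using countable_balls by (rule countable_subset[rotated]) auto
  moreover have "?C \<subseteq> sets M" by auto
  ultimately show ?thesis by (metis (no_types, lifting) sets.countable_Union)
qed

lemma singleton_sets [measurable, simp]: "{a} \<in> sets M"
proof -
  have "- {a} \<in> sets M"
  proof (rule open_sets)
    fix x assume "x \<in> - {a}"
    then have "x - a \<noteq> 0" by simp
    then have "B x (v (x - a) + 1) \<subseteq> - {a}"
      using P_minus[of "x - a"] by (auto simp: vid_def)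
    then show "\<exists>k. B x k \<subseteq> - {a}" by blast
  qed
  then show ?thesis using sets.compl_sets[of "- {a}" M] by (simp add: Compl_eq_Diff_UNIV[symmetric])
qed

text \<open>The exceptional point \<open>z\<close> admits functions such as \<open>nrm\<close> and
  \<open>w\<close>, which are locally constant only away from 0.\<close>

lemma locally_constant_measurable:
  fixes g :: "'a \<Rightarrow> 'b::topological_space"
  assumes "\<And>x. x \<noteq> z \<Longrightarrow> \<exists>k. \<forall>y\<in>B x k. g y = g x"
  shows "g \<in> borel_measurable M"
proof (rule borel_measurableI)
  fix S :: "'b set"
  have "g -` S - {z} \<in> sets M"
  proof (rule open_sets)
    fix x assume x: "x \<in> g -` S - {z}"
    then obtain k where k: "\<forall>y\<in>B x k. g y = g x" using assms by blast
    have "B x (max k (v (z - x) + 1)) \<subseteq> g -` S - {z}"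
    proof
      fix y assume y: "y \<in> B x (max k (v (z - x) + 1))"
      then have "y \<in> B x k" by simp
      then have "g y = g x" by (rule bspec[OF k])
      moreover have "y \<noteq> z" using y x by (auto simp: vid_def)
      ultimately show "y \<in> g -` S - {z}" using x by simp
    qed
    then show "\<exists>k. B x k \<subseteq> g -` S - {z}" by blast
  qed
  moreover have "{z} \<inter> g -` S \<in> sets M"
    by (cases "g z \<in> S") auto
  ultimately have "(g -` S - {z}) \<union> ({z} \<inter> g -` S) \<in> sets M" by blast
  moreover have "(g -` S - {z}) \<union> ({z} \<inter> g -` S) = g -` S" by blast
  ultimately show "g -` S \<inter> space M \<in> sets M" by simp
qed

section \<open>Convergence in the valuation topology\<close>

definition nb :: "'a \<Rightarrow> 'a filter" where
  "nb a = (INF k. principal (B a k))"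

lemma eventually_nb: "eventually Q (nb a) \<longleftrightarrow> (\<exists>k. \<forall>x\<in>B a k. Q x)"
proof -
  have "eventually Q (nb a) \<longleftrightarrow> (\<exists>k\<in>UNIV. eventually Q (principal (B a k)))"
    unfolding nb_def
  proof (rule eventually_INF_base)
    fix j k :: int
    show "\<exists>i\<in>UNIV. principal (B a i) \<le> inf (principal (B a j)) (principal (B a k))"
      by (rule bexI[of _ "max j k"]) auto
  qed simp
  then show ?thesis by (simp add: eventually_principal)
qed

lemma eventually_nb_prodE:
  assumes "eventually Q (nb a \<times>\<^sub>F nb b)"
  obtains N where "\<And>y z. y \<in> B a N \<Longrightarrow> z \<in> B b N \<Longrightarrow> Q (y, z)"
proof -
  obtain Qa Qb where Q: "eventually Qa (nb a)" "eventually Qb (nb b)"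
    "\<And>y z. Qa y \<Longrightarrow> Qb z \<Longrightarrow> Q (y, z)"
    using assms by (auto simp: eventually_prod_filter)
  then obtain j k where "\<forall>y\<in>B a j. Qa y" "\<forall>z\<in>B b k. Qb z" by (auto simp: eventually_nb)
  then show thesis using Q(3) by (intro that[of "max j k"]) auto
qed

text \<open>The field type carries no topology, so limits are expressed through the ideals
  \<open>P k\<close>. An arbitrary source filter allows products of neighbourhood filters, hence
  functions of two variables.\<close>

definition vlim :: "('b \<Rightarrow> 'a) \<Rightarrow> 'a \<Rightarrow> 'b filter \<Rightarrow> bool" where
  "vlim g l F \<longleftrightarrow> (\<forall>k. \<forall>\<^sub>F x in F. g x - l \<in> P k)"

lemma vlimD: "vlim g l F \<Longrightarrow> \<forall>\<^sub>F x in F. g x - l \<in> P k"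
  by (simp add: vlim_def)

lemma vlim_const: "vlim (\<lambda>_. c) c F"
  by (simp add: vlim_def)

lemma vlim_ident: "vlim (\<lambda>x. x) a (nb a)"
  unfolding vlim_def eventually_nb by blast

lemma vlim_compose: "vlim g l F \<Longrightarrow> filterlim f F G \<Longrightarrow> vlim (\<lambda>x. g (f x)) l G"
  unfolding vlim_def filterlim_iff by blast

lemma vlim_fst: "vlim fst a (nb a \<times>\<^sub>F nb b)"
  by (rule vlim_compose[OF vlim_ident filterlim_fst])

lemma vlim_snd: "vlim snd b (nb a \<times>\<^sub>F nb b)"
  by (rule vlim_compose[OF vlim_ident filterlim_snd])

lemma vlim_add:
  assumes "vlim g l F" "vlim h l' F"
  shows "vlim (\<lambda>x. g x + h x) (l + l') F"
  unfolding vlim_def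
proof
  fix k
  show "\<forall>\<^sub>F x in F. g x + h x - (l + l') \<in> P k"
    using vlimD[OF assms(1), of k] vlimD[OF assms(2), of k]
  proof eventually_elim
    case (elim x)
    from P_add[OF this] show ?case by (simp add: algebra_simps)
  qed
qed

lemma vlim_mult:
  assumes "vlim g l F" "vlim h l' F"
  shows "vlim (\<lambda>x. g x * h x) (l * l') F"
  unfolding vlim_def
proof
  fix k
  show "\<forall>\<^sub>F x in F. g x * h x - l * l' \<in> P k"
    using vlimD[OF assms(1), of "max 0 (k - v l')"] vlimD[OF assms(2), of "max k (k - v l)"]
  proof eventually_elim
    case (elim x)
    have e: "g x * h x - l * l' = (g x - l) * (h x - l') + l * (h x - l') + (g x - l) * l'"
      by (simp add: algebra_simps)
    have "(g x - l) * (h x - l') \<in> P k"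
      using P_mult[of "g x - l" 0 "h x - l'" k] elim by simp
    moreover have "l * (h x - l') \<in> P k"
      using P_mult[of l "v l" "h x - l'" "k - v l"] elim by simp
    moreover have "(g x - l) * l' \<in> P k"
      using P_mult[of "g x - l" "k - v l'" l' "v l'"] elim by simp
    ultimately show ?case unfolding e by (intro P_add)
  qed
qed

lemma vlim_minus: "vlim g l F \<Longrightarrow> vlim (\<lambda>x. - g x) (- l) F"
  using vlim_mult[OF vlim_const[of "-1"], of g l F] by simp

lemma vlim_diff: "vlim g l F \<Longrightarrow> vlim h l' F \<Longrightarrow> vlim (\<lambda>x. g x - h x) (l - l') F"
  using vlim_add[OF _ vlim_minus, of g l F h l'] by simp

lemma vlim_power2: "vlim g l F \<Longrightarrow> vlim (\<lambda>x. (g x)^2) (l^2) F"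
  unfolding power2_eq_square by (rule vlim_mult)

lemmas vlim_intros = vlim_const vlim_ident vlim_fst vlim_snd vlim_add vlim_diff vlim_minus
  vlim_power2 vlim_mult

lemma vlim_nonzero:
  assumes "vlim g l F" "l \<noteq> 0"
  shows "\<forall>\<^sub>F x in F. g x \<noteq> 0 \<and> v (g x) = v l \<and> nrm (g x) = nrm l"
  using vlimD[OF assms(1), of "v l + 1"]
proof eventually_elim
  case (elim x)
  then show ?case using v_add_eq[OF assms(2), of "g x - l"] assms(2) by (auto intro: nrm_eq)
qed

text \<open>Balls are open and closed, so the indicator of the preimage of a ball is locally
  constant away from \<open>z\<close>.\<close>

lemma continuous_measurable:
  assumes "\<And>x. x \<noteq> z \<Longrightarrow> vlim g (g x) (nb x)"
  shows "g \<in> measurable M M"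
  unfolding sets_M[symmetric]
proof (rule measurable_sigma_sets[OF sets_M])
  fix S assume "S \<in> range (\<lambda>(a, k). B a k)"
  then obtain a k where S: "S = B a k" by auto
  have "(\<lambda>x. indicator (g -` S) x :: real) \<in> borel_measurable M"
  proof (rule locally_constant_measurable)
    fix x assume "x \<noteq> z"
    then obtain j where j: "\<forall>y\<in>B x j. g y - g x \<in> P k"
        using assms[of x] unfolding vlim_def eventually_nb by blast
    have "indicator (g -` S) y = (indicator (g -` S) x :: real)" if "y \<in> B x j" for y
      using P_add_iff[of "g y - g x" k "g x - a"] bspec[OF j that] by (simp add: S indicator_def)
    then show "\<exists>k. \<forall>y\<in>B x k. indicator (g -` S) y = (indicator (g -` S) x :: real)"
      by blast
  qed
  then have "g -` S \<in> sets M" by (simp add: borel_measurable_indicator_iff)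
  then show "g -` S \<inter> space M \<in> sets M" by simp
qed auto

lemma quadratic_measurable [measurable]: "(\<lambda>x. a * x^2 + b * x + c) \<in> measurable M M"
  by (intro continuous_measurable vlim_intros)

lemma affine_measurable [measurable]: "(\<lambda>x. a * x + b) \<in> measurable M M"
  by (intro continuous_measurable vlim_intros)

lemma divide_measurable: "(\<lambda>x. a / x) \<in> measurable M M"
proof (rule continuous_measurable[of 0])
  fix x assume x: "x \<noteq> (0::'a)"
  have "a / y - a / x \<in> P k" if y: "y \<in> B x (max (v x + 1) (k - v a + 2 * v x))" for y k
  proof (cases "a = 0 \<or> y = x")
    case False
    have "y - x \<in> P (v x + 1)" and 2: "y - x \<in> P (k - v a + 2 * v x)" using y by auto
    then have y: "y \<noteq> 0" "v y = v x" using v_add_eq[OF x, of "y - x"] by auto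
    have "a / y - a / x = a * (x - y) / (x * y)" using x y by (simp add: field_simps)
    moreover have "x - y \<in> P (k - v a + 2 * v x)" using 2 P_diff_commute by blast
    moreover have "a \<noteq> 0" "x \<noteq> y" using False by auto
    ultimately show ?thesis using x y by (simp add: vid_def v_mult v_divide)
  qed auto
  then show "vlim (\<lambda>x. a / x) (a / x) (nb x)" unfolding vlim_def eventually_nb by blast
qed

lemma nrm_measurable [measurable]: "nrm \<in> borel_measurable M"
proof (rule locally_constant_measurable[of 0])
  fix x assume x: "x \<noteq> (0::'a)"
  have "nrm y = nrm x" if "y \<in> B x (v x + 1)" for y
    using v_add_eq[OF x, of "y - x"] that x by (auto intro!: nrm_eq)
  then show "\<exists>k. \<forall>y\<in>B x k. nrm y = nrm x" by blast
qed

lemma w_measurable [measurable]: "w \<in> borel_measurable M"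
proof (rule locally_constant_measurable[of 0])
  fix x assume x: "x \<noteq> (0::'a)"
  then show "\<exists>k. \<forall>y\<in>B x k. w y = w x" using w_near[OF x] by blast
qed

section \<open>Measure of balls and change of variables\<close>

lemma emeasure_translate: "S \<in> sets M \<Longrightarrow> emeasure M ((\<lambda>x. x + c) ` S) = emeasure M S"
  using haar by (simp add: haar_measure_def)

lemma emeasure_ball: "emeasure M (B a k) = emeasure M (P k)"
proof -
  have "B a k = (\<lambda>x. x + a) ` P k"
  proof safe
    fix x assume "x - a \<in> P k"
    then show "x \<in> (\<lambda>x. x + a) ` P k" by (intro image_eqI[of _ _ "x - a"]) auto
  qed simp
  then show ?thesis using emeasure_translate[of "P k" a] by simp
qed

text \<open>\<open>P k\<close> is a disjoint union of \<open>q\<close> translates of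
  \<open>P (k + 1)\<close>, so translation invariance gives a ratio \<open>q\<close>; the
  normalization at \<open>k = 0\<close> then fixes all levels in both directions.\<close>

lemma emeasure_P: "emeasure M (P k) = ennreal (real q powr (- real_of_int k))"
proof -
  have step: "emeasure M (P k) = ennreal (real q) * emeasure M (P (k + 1))" for k
  proof -
    obtain R where R: "finite R" "card R = q"
      "B 0 k = (\<Union>r\<in>R. B (0 + r) (k + 1))" "disjoint_family_on (\<lambda>r. B (0 + r) (k + 1)) R"
      using ball_split[of k] by metis
    have "emeasure M (P k) = emeasure M (\<Union>r\<in>R. B (0 + r) (k + 1))"
      using R(3) by simp
    also have "\<dots> = (\<Sum>r\<in>R. emeasure M (B (0 + r) (k + 1)))"
      using R by (intro sum_emeasure[symmetric]) auto
    also have "\<dots> = of_nat q * emeasure M (P (k + 1))"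
      using R by (simp add: emeasure_ball)
    finally show ?thesis by (simp add: ennreal_of_nat_eq_real_of_nat)
  qed
  show ?thesis
  proof (induction k rule: int_induct[of _ 0])
    case base
    have "val_ring v = P 0" by (auto simp: val_ring_def vid_def)
    then show ?case using haar q_gt_1 by (simp add: haar_measure_def)
  next
    case (step1 i)
    have "emeasure M (P (i + 1)) = ennreal (1 / real q) * (ennreal (real q) * emeasure M (P (i + 1)))"
      using q_gt_1 by (simp add: mult.assoc[symmetric] ennreal_mult[symmetric])
    also have "\<dots> = ennreal (1 / real q) * ennreal (real q powr (- real_of_int i))"
      using step[of i] step1 by simp
    also have "\<dots> = ennreal (real q powr (-1) * real q powr (- real_of_int i))"
      using q_gt_1 by (subst ennreal_mult[symmetric]) (auto simp: powr_minus inverse_eq_divide)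
    also have "\<dots> = ennreal (real q powr (- real_of_int (i + 1)))"
      by (subst powr_add[symmetric]) (simp add: algebra_simps)
    finally show ?case .
  next
    case (step2 i)
    have "emeasure M (P (i - 1)) = ennreal (real q) * ennreal (real q powr (- real_of_int i))"
      using step[of "i - 1"] step2 by simp
    also have "\<dots> = ennreal (real q powr 1 * real q powr (- real_of_int i))"
      using q_gt_1 by (subst ennreal_mult[symmetric]) auto
    also have "\<dots> = ennreal (real q powr (- real_of_int (i - 1)))"
      by (subst powr_add[symmetric]) (simp add: algebra_simps)
    finally show ?case .
  qed
qed

text \<open>The measure of a ball depends only on its level, so \<open>M\<close> and its image agree
  on balls. Two balls are nested or disjoint, hence balls form an intersection-stable generator and
  the measures coincide.\<close>

lemma distr_eqI:
  assumes [measurable]: "g \<in> measurable M M" and "\<And>a k. \<exists>b. g -` B a k = B b k"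
  shows "distr M M g = M"
proof -
  \<comment> \<open>The empty set is added because disjoint balls must have their intersection in
    the generator.\<close>
  let ?E = "insert {} (range (\<lambda>(a, k). B a k))"
  have sets: "sets M = sigma_sets UNIV ?E"
  proof -
    have "sigma_sets UNIV ?E = sigma_sets UNIV (range (\<lambda>(a, k). B a k))"
    proof (rule sigma_sets_eqI)
      fix S assume "S \<in> ?E"
      then show "S \<in> sigma_sets UNIV (range (\<lambda>(a, k). B a k))"
        by (auto intro: sigma_sets.Empty sigma_sets.Basic)
    qed (auto intro: sigma_sets.Basic)
    then show ?thesis by (simp add: sets_M)
  qed
  have nested: "B a j \<inter> B b k \<in> ?E" if "j \<le> k" for a b j k
  proof (cases "B a j \<inter> B b k = {}")
    case False
    then obtain x where x: "x \<in> B a j" "x \<in> B b k" by blast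
    have "B x k \<subseteq> B x j" using P_mono[OF that] by auto
    then have "B a j \<inter> B b k = B b k" using ball_eq[OF x(1)] ball_eq[OF x(2)] by blast
    then show ?thesis by auto
  qed simp
  have "M = distr M M g"
  proof (rule measure_eqI_generator_eq)
    show "Int_stable ?E"
    proof (rule Int_stableI)
      fix S T assume "S \<in> ?E" "T \<in> ?E"
      then consider "S = {} \<or> T = {}" | a j b k where "S = B a j" "T = B b k" by auto
      then show "S \<inter> T \<in> ?E"
      proof cases
        case 2
        show ?thesis
        proof (cases "j \<le> k")
          case False
          then show ?thesis using nested[of k j b a] by (simp add: 2 Int_commute)
        qed (use nested in \<open>simp add: 2\<close>)
      qed auto
    qed
    show "emeasure M S = emeasure (distr M M g) S" if S: "S \<in> ?E" for S
    proof (cases "S = {}")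
      case False
      with S obtain a k where "S = B a k" by auto
      then show ?thesis using assms(2)[of a k] by (auto simp: emeasure_distr emeasure_ball)
    qed simp
    show "range (\<lambda>n::nat. P (- int n)) \<subseteq> ?E"
      by (auto intro!: image_eqI[of _ _ "(0, _)"])
    show "(\<Union>n::nat. P (- int n)) = UNIV"
    proof safe
      fix x
      have "x \<in> P (- int (nat (- v x)))" by (rule P_mono[OF _ P_self]) simp
      then show "x \<in> (\<Union>n::nat. P (- int n))" by blast
    qed simp
  qed (auto simp: sets emeasure_P)
  then show ?thesis by simp
qed

lemma nn_integral_affine:
  assumes [measurable]: "g \<in> borel_measurable M" and a: "a \<noteq> 0" "v a = 0"
  shows "(\<integral>\<^sup>+x. g (a * x + b) \<partial>M) = (\<integral>\<^sup>+x. g x \<partial>M)"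
proof -
  have "distr M M (\<lambda>x. a * x + b) = M"
  proof (rule distr_eqI)
    show "\<exists>c'. (\<lambda>x. a * x + b) -` B c k = B c' k" for c k
    proof
      have "a * (x - (c - b) / a) = a * x + b - c" for x
        using a by (simp add: field_simps)
      then have "x - (c - b) / a \<in> P k \<longleftrightarrow> a * x + b - c \<in> P k" for x
        using P_mult_iff'[OF a(1), of "x - (c - b) / a" k] a(2) by simp
      then show "(\<lambda>x. a * x + b) -` B c k = B ((c - b) / a) k"
        by auto
    qed
  qed simp
  then have "(\<integral>\<^sup>+x. g x \<partial>M) = (\<integral>\<^sup>+x. g x \<partial>distr M M (\<lambda>x. a * x + b))" by simp
  also have "\<dots> = (\<integral>\<^sup>+x. g (a * x + b) \<partial>M)" by (rule nn_integral_distr) auto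
  finally show ?thesis by simp
qed

text \<open>One dominating term per point suffices, so the balls need not be disjoint.\<close>
lemma nn_integral_shells:
  assumes g: "\<And>x. x \<in> T \<Longrightarrow> x \<noteq> 0 \<Longrightarrow> (\<exists>i. x \<in> P (u i) \<and> g x \<le> c i)"
    and "\<And>i. c i \<ge> 0" and sm: "summable (\<lambda>i::nat. c i * real q powr (- real_of_int (u i)))"
  shows "(\<integral>\<^sup>+x. indicator (T - {0}) x * ennreal (g x) \<partial>M) < \<infinity>"
proof -
  have "(\<integral>\<^sup>+x. indicator (T - {0}) x * ennreal (g x) \<partial>M)
      \<le> (\<integral>\<^sup>+x. (\<Sum>i. ennreal (c i) * indicator (P (u i)) x) \<partial>M)"
  proof (rule nn_integral_mono)
    fix x
    show "indicator (T - {0}) x * ennreal (g x) \<le> (\<Sum>i. ennreal (c i) * indicator (P (u i)) x)"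
    proof (cases "x \<in> T - {0}")
      case True
      then obtain i where i: "x \<in> P (u i)" "g x \<le> c i" using g by blast
      define f where "f j = ennreal (c j) * indicator (P (u j)) x" for j
      have "ennreal (g x) \<le> f i" using i assms by (simp add: f_def ennreal_leI)
      also have "\<dots> \<le> (\<Sum>j. f j)" using sum_le_suminf[OF summableI, of "{i}" f] by simp
      also have "\<dots> = (\<Sum>i. ennreal (c i) * indicator (P (u i)) x)" by (simp add: f_def)
      finally show ?thesis using True by simp
    qed simp
  qed
  also have "\<dots> = (\<Sum>i. \<integral>\<^sup>+x. ennreal (c i) * indicator (P (u i)) x \<partial>M)"
    by (rule nn_integral_suminf) simp
  also have "\<dots> = (\<Sum>i. ennreal (c i * real q powr (- real_of_int (u i))))"
    using assms by (simp add: nn_integral_cmult emeasure_P ennreal_mult)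
  also have "\<dots> = ennreal (\<Sum>i. c i * real q powr (- real_of_int (u i)))"
    using assms by (intro suminf_ennreal2) auto
  also have "\<dots> < \<infinity>" by simp
  finally show ?thesis .
qed

section \<open>Singular integrals\<close>

lemma summable_powr:
  assumes "s > 0"
  shows "summable (\<lambda>i::nat. real q powr (r - s * real i))"
proof -
  have "real q powr (r - s * real i) = real q powr r * (real q powr (- s)) ^ i" for i
  proof -
    have "(real q powr (- s)) ^ i = real q powr (- s * real i)"
      using q_gt_1 by (simp flip: powr_realpow add: powr_powr)
    then show ?thesis by (simp flip: powr_add)
  qed
  moreover have "real q powr (- s) < 1" using q_gt_1 assms by (simp add: powr_less_one)
  ultimately show ?thesis using q_gt_1 by (simp add: summable_geometric)
qed

lemma nrm_powr: "x \<noteq> 0 \<Longrightarrow> nrm x powr r = real q powr (- real_of_int (v x) * r)"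
  by (simp add: absv_def powr_powr)

lemma nrm_less: "s \<noteq> 0 \<Longrightarrow> nrm x < nrm s \<longleftrightarrow> x \<in> P (v s + 1)"
  using nrm_less_iff[of x "v s"] by (simp add: absv_def)

lemma AE_neq: "AE x in M. x \<noteq> a"
proof -
  have small: "emeasure M {a} \<le> ennreal e" if e: "e > 0" for e :: real
  proof -
    have "1 / real q < 1" using q_gt_1 by simp
    then obtain n where n: "(1 / real q)^n < e" using real_arch_pow_inv e by blast
    have "emeasure M {a} \<le> emeasure M (B a (int n))" by (rule emeasure_mono) auto
    also have "\<dots> = ennreal ((1 / real q)^n)"
      using q_gt_1 by (simp add: emeasure_ball emeasure_P powr_minus powr_realpow power_one_over inverse_eq_divide)
    also have "\<dots> \<le> ennreal e" using n by (simp add: ennreal_leI)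
    finally show ?thesis .
  qed
  have "emeasure M {a} \<le> 0" by (rule ennreal_le_epsilon) (use small in simp)
  then have "{a} \<in> null_sets M" by (simp add: null_sets_def)
  from AE_not_in[OF this] show ?thesis by simp
qed

text \<open>Where \<open>v x = m + i\<close> the integrand is \<open>q\<close> to the power
  \<open>(m + i) / 2\<close>, while \<open>P (m + i)\<close> has measure \<open>q\<close> to the
  power \<open>-(m + i)\<close>: a geometric series of ratio \<open>q powr (- 1/2)\<close>.\<close>

lemma finite_singular_integral:
  "(\<integral>\<^sup>+x. indicator (P m) x * ennreal (nrm x powr (- 1/2)) \<partial>M) < \<infinity>"
proof -
  let ?c = "\<lambda>i::nat. real q powr ((m + int i) * (1/2))"
  have "(\<integral>\<^sup>+x. indicator (P m - {0}) x * ennreal (nrm x powr (- 1/2)) \<partial>M) < \<infinity>"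
  proof (rule nn_integral_shells[where u = "\<lambda>i. m + int i" and c = ?c])
    fix x assume x: "x \<in> P m" "x \<noteq> 0"
    then have "m + int (nat (v x - m)) = v x" by (simp add: vid_def)
    then show "\<exists>i. x \<in> P (m + int i) \<and> nrm x powr (- 1/2) \<le> ?c i"
      using x by (intro exI[of _ "nat (v x - m)"]) (simp add: nrm_powr)
  next
    have "?c i * real q powr (- real_of_int (m + int i)) = real q powr (- m / 2 - 1/2 * real i)" for i
      by (subst powr_add[symmetric]) (simp add: field_simps)
    then show "summable (\<lambda>i. ?c i * real q powr (- real_of_int (m + int i)))"
      using summable_powr[of "1/2"] by simp
  qed simp
  also have "(\<integral>\<^sup>+x. indicator (P m - {0}) x * ennreal (nrm x powr (- 1/2)) \<partial>M)
      = (\<integral>\<^sup>+x. indicator (P m) x * ennreal (nrm x powr (- 1/2)) \<partial>M)"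
    by (intro nn_integral_cong) (auto simp: indicator_def)
  finally show ?thesis .
qed

text \<open>The exponent \<open>-3/2\<close> is \<open>-2 + 1/2\<close>: the square of the
  half-density factor \<open>1 / nrm y\<close> times the square of a singularity of order
  \<open>1/4\<close> read at \<open>t / y\<close>.\<close>

lemma finite_integral_at_infinity:
  "(\<integral>\<^sup>+x. indicator ({x. v x \<le> n} - {0}) x * ennreal (nrm x powr (- 3/2)) \<partial>M) < \<infinity>"
proof -
  let ?c = "\<lambda>i::nat. real q powr ((n - int i) * (3/2))"
  show ?thesis
  proof (rule nn_integral_shells[where u = "\<lambda>i. n - int i" and c = ?c])
    fix x :: 'a assume x: "x \<in> {x. v x \<le> n}" "x \<noteq> 0"
    then have "n - int (nat (n - v x)) = v x" by simp
    then show "\<exists>i. x \<in> P (n - int i) \<and> nrm x powr (- 3/2) \<le> ?c i"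
      using x by (intro exI[of _ "nat (n - v x)"]) (simp add: nrm_powr)
  next
    have "?c i * real q powr (- real_of_int (n - int i)) = real q powr (n / 2 - 1/2 * real i)" for i
      by (subst powr_add[symmetric]) (simp add: field_simps)
    then show "summable (\<lambda>i. ?c i * real q powr (- real_of_int (n - int i)))"
      using summable_powr[of "1/2"] by simp
  qed simp
qed

text \<open>Uniformity in \<open>s\<close> is the point, since the roots of \<open>U^2 = D\<close>
  move with \<open>D\<close>. For \<open>s\<close> in \<open>P m\<close> a translation preserves the
  ball; otherwise \<open>x - s\<close> is never in \<open>P m\<close> and the integrand is
  bounded.\<close>

lemma translated_singular_integral_bound:
  obtains J where "J \<ge> 0"
    "\<And>s. (\<integral>\<^sup>+x. indicator (P m) x * ennreal (nrm (x - s) powr (- 1/2)) \<partial>M) \<le> ennreal J"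
proof -
  let ?I = "\<integral>\<^sup>+x. indicator (P m) x * ennreal (nrm x powr (- 1/2)) \<partial>M"
  define J where "J = enn2real ?I + real q powr (m / 2) * real q powr (- m)"
  have I: "?I = ennreal (enn2real ?I)" using finite_singular_integral[of m] by simp
  have "(\<integral>\<^sup>+x. indicator (P m) x * ennreal (nrm (x - s) powr (- 1/2)) \<partial>M) \<le> ennreal J" for s
  proof (cases "s \<in> P m")
    case True
    have "(\<integral>\<^sup>+x. indicator (P m) x * ennreal (nrm (x - s) powr (- 1/2)) \<partial>M)
        = (\<integral>\<^sup>+x. indicator (P m) (1 * x + (- s)) * ennreal (nrm (1 * x + (- s)) powr (- 1/2)) \<partial>M)"
      using P_add_iff[of "- s" m] True by (intro nn_integral_cong) (auto simp: indicator_def)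
    also have "\<dots> = ?I" by (rule nn_integral_affine) auto
    also have "\<dots> \<le> ennreal J" by (subst I) (auto simp: J_def intro!: ennreal_leI)
    finally show ?thesis .
  next
    case False
    have "nrm (x - s) powr (- 1/2) \<le> real q powr (m / 2)" if x: "x \<in> P m" for x
    proof -
      have "x - s \<notin> P m" using P_add_iff[OF x, of "- s"] False by simp
      then have "x - s \<noteq> 0" "v (x - s) < m" by (auto simp: vid_def)
      then show ?thesis using q_gt_1 by (simp add: nrm_powr powr_le_cancel_iff)
    qed
    then have "(\<integral>\<^sup>+x. indicator (P m) x * ennreal (nrm (x - s) powr (- 1/2)) \<partial>M)
        \<le> (\<integral>\<^sup>+x. ennreal (real q powr (m / 2)) * indicator (P m) x \<partial>M)"
      by (intro nn_integral_mono) (auto simp: indicator_def intro!: ennreal_leI)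
    also have "\<dots> = ennreal (real q powr (m / 2) * real q powr (- m))"
      by (simp add: nn_integral_cmult emeasure_P ennreal_mult)
    also have "\<dots> \<le> ennreal J" by (simp add: J_def ennreal_leI)
    finally show ?thesis .
  qed
  moreover have "J \<ge> 0" by (simp add: J_def)
  ultimately show thesis by (rule that[rotated])
qed

text \<open>The integral left after completing the square: \<open>U = \<alpha> * h + c\<close> with
  \<open>h\<close> measured from the centre of the ball, and \<open>D\<close> the
  discriminant.\<close>

definition phi :: "int \<Rightarrow> 'a \<Rightarrow> 'a \<Rightarrow> 'a \<Rightarrow> ennreal" where
  "phi m \<alpha> c D = (\<integral>\<^sup>+h. indicator (P m) h * ennreal (w ((\<alpha> * h + c)^2 - D)) \<partial>M)"

lemma w_quadratic_measurable [measurable]: "(\<lambda>h. w ((\<alpha> * h + c)^2 - D)) \<in> borel_measurable M"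
proof -
  have "(\<lambda>h. (\<alpha> * h + c)^2 - D) = (\<lambda>h. \<alpha>^2 * h^2 + (2 * \<alpha> * c) * h + (c^2 - D))"
    by (rule ext) (simp add: power2_eq_square algebra_simps)
  then have "(\<lambda>h. (\<alpha> * h + c)^2 - D) \<in> measurable M M" by simp
  then show ?thesis by (rule measurable_compose) simp
qed

lemma phi_unit:
  assumes "r \<noteq> 0" "v r = 0"
  shows "phi m (\<alpha> * r) c D = phi m \<alpha> c D"
proof -
  have "phi m \<alpha> c D = (\<integral>\<^sup>+h. indicator (P m) (r * h + 0) * ennreal (w ((\<alpha> * (r * h + 0) + c)^2 - D)) \<partial>M)"
    unfolding phi_def by (rule nn_integral_affine[symmetric]) (use assms in auto)
  also have "\<dots> = phi m (\<alpha> * r) c D"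
    unfolding phi_def using P_mult_iff'[OF assms(1)] assms(2)
    by (intro nn_integral_cong) (auto simp: indicator_def mult.assoc)
  finally show ?thesis by simp
qed

lemma phi_shift:
  assumes "d \<in> P m"
  shows "phi m \<alpha> (c + \<alpha> * d) D = phi m \<alpha> c D"
proof -
  have "phi m \<alpha> c D = (\<integral>\<^sup>+h. indicator (P m) (1 * h + d) * ennreal (w ((\<alpha> * (1 * h + d) + c)^2 - D)) \<partial>M)"
    unfolding phi_def by (rule nn_integral_affine[symmetric]) auto
  also have "\<dots> = phi m \<alpha> (c + \<alpha> * d) D"
    unfolding phi_def using P_add_iff[OF assms]
    by (intro nn_integral_cong) (auto simp: indicator_def algebra_simps)
  finally show ?thesis by simp
qed

text \<open>Taking \<open>r^2\<close> out of \<open>U^2 - r^2 * D\<close> replaces \<open>U\<close>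
  by \<open>U / r\<close> at no cost, as \<open>nrm r = 1\<close>; the changed slope is undone by
  \<open>phi_unit\<close>.\<close>

lemma phi_scale:
  assumes "r \<noteq> 0" "v r = 0"
  shows "phi m \<alpha> c (r^2 * D) = phi m \<alpha> (c / r) D"
proof -
  have nr: "nrm r = 1" using assms q_gt_1 by (simp add: absv_def)
  have "(\<alpha> * h + c)^2 - r^2 * D = r^2 * ((\<alpha> * inverse r * h + c / r)^2 - D)" for h
    using assms by (simp add: field_simps power2_eq_square)
  then have "phi m \<alpha> c (r^2 * D) = phi m (\<alpha> * inverse r) (c / r) D"
    by (simp add: phi_def w_mult[OF assms(1)] nr)
  also have "\<dots> = phi m \<alpha> (c / r) D"
    by (rule phi_unit) (use assms v_inverse[of r] in auto)
  finally show ?thesis .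
qed

text \<open>Scaling \<open>D\<close> by \<open>r^2\<close> amounts to dividing the centre by
  \<open>r\<close>, and the centre matters only modulo \<open>\<alpha>\<close> times
  \<open>P m\<close>, because such a shift is a translation of the ball into itself.\<close>

lemma phi_cong:
  assumes r: "r \<noteq> 0" "v r = 0" and \<alpha>: "\<alpha> \<noteq> 0" and c: "c' - c * r \<in> P (m + v \<alpha>)"
  shows "phi m \<alpha> c' (r^2 * D) = phi m \<alpha> c D"
proof -
  define d where "d = (c' / r - c) / \<alpha>"
  have e: "\<alpha> * (r * d) = c' - c * r" using r \<alpha> by (simp add: d_def field_simps)
  have "r * d \<in> P m" using c P_mult_iff'[OF \<alpha>, of "r * d" "m + v \<alpha>"] e by simp
  then have "d \<in> P m" using P_mult_iff'[OF r(1), of d m] r by simp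
  moreover have "c' / r = c + \<alpha> * d" using \<alpha> by (simp add: d_def)
  ultimately show ?thesis using phi_scale[OF r, of m \<alpha> c' D] phi_shift by simp
qed

text \<open>If \<open>D = s\<^sup>2\<close>, one of \<open>U - s\<close>, \<open>U + s\<close> has norm at least that of \<open>s\<close>; if \<open>D\<close> is not a square,
  no cancellation occurs in \<open>U\<^sup>2 - D\<close>.\<close>
lemma w_square_diff_le:
  assumes D: "D \<noteq> 0"
  obtains s where "\<And>U. U \<noteq> 0 \<Longrightarrow> w (U^2 - D) \<le> nrm D powr (- 1/4) * (nrm (U - s) powr (- 1/2) + nrm (U + s) powr (- 1/2))"
proof (cases "\<exists>s. s^2 = D")
  case True
  then obtain s where s: "s^2 = D" by blast
  then have s0: "s \<noteq> 0" using D by auto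
  have ns: "nrm s powr (- 1/2) = nrm D powr (- 1/4)"
    using s nrm_power2[of s] nrm_pos[OF s0] by (simp flip: s add: powr_power[symmetric] powr_powr powr_numeral[symmetric] del: powr_numeral)
  have "w (U^2 - D) \<le> nrm D powr (- 1/4) * (nrm (U - s) powr (- 1/2) + nrm (U + s) powr (- 1/2))" for U
  proof -
    have e: "U^2 - D = (U - s) * (U + s)" by (simp flip: s add: power2_eq_square algebra_simps)
    have bound: "(nrm X * nrm Y) powr (- 1/2) \<le> nrm s powr (- 1/2) * nrm Y powr (- 1/2)" if "nrm s \<le> nrm X" for X Y
    proof -
      have "nrm X powr (- 1/2) \<le> nrm s powr (- 1/2)"
        using that nrm_pos[OF s0] by (intro powr_mono2') auto
      then show ?thesis by (simp add: powr_mult mult_right_mono)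
    qed
    have "nrm s \<le> nrm (U - s) \<or> nrm s \<le> nrm (U + s)"
    proof (rule ccontr)
      assume "\<not> ?thesis"
      then have "U - s \<in> P (v s + 1)" "U + s \<in> P (v s + 1)"
        using nrm_less[OF s0] by (auto simp: not_le)
      then have "2 * s \<in> P (v s + 1)" using P_diff[of "U + s" _ "U - s"] by (simp add: algebra_simps)
      then show False using two_nz s0 by (simp add: vid_def v_mult v_2)
    qed
    then have "(nrm (U - s) * nrm (U + s)) powr (- 1/2)
        \<le> nrm s powr (- 1/2) * (nrm (U - s) powr (- 1/2) + nrm (U + s) powr (- 1/2))"
      using bound[of "U - s" "U + s"] bound[of "U + s" "U - s"]
      by (auto simp: distrib_left mult.commute intro: order_trans)
    moreover have "w (U^2 - D) \<le> (nrm (U - s) * nrm (U + s)) powr (- 1/2)"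
      using w_le[of "U^2 - D"] by (simp add: e nrm_mult)
    ultimately show ?thesis unfolding ns by linarith
  qed
  then show thesis by (rule that)
next
  case False
  \<comment> \<open>Here the witness is \<open>s = 0\<close>. The restriction
    \<open>U \<noteq> 0\<close> is essential: \<open>0 powr _ = 0\<close> would make the right side
    vanish, while \<open>w (- D)\<close> may be positive.\<close>
  have "w (U^2 - D) \<le> nrm D powr (- 1/4) * (nrm (U - 0) powr (- 1/2) + nrm (U + 0) powr (- 1/2))"
    if U: "U \<noteq> 0" for U
  proof -
    have DU: "D - U^2 \<notin> P (v (U^2) + 1)"
    proof
      assume "D - U^2 \<in> P (v (U^2) + 1)"
      then obtain r where "D = r^2 * U^2"
        using near_is_square_multiple[of "U^2" D 1] U by auto
      then have "(r * U)^2 = D" by (simp add: power_mult_distrib)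
      then show False using False by blast
    qed
    have UD: "U^2 - D \<notin> P (v D + 1)"
    proof
      assume "U^2 - D \<in> P (v D + 1)"
      then obtain r where "U^2 = r^2 * D" "r \<noteq> 0"
        using near_is_square_multiple[of D "U^2" 1] D by auto
      then have "(U / r)^2 = D" by (simp add: power_divide)
      then show False using False by blast
    qed
    have nz: "U^2 - D \<noteq> 0" using False by auto
    have "nrm D \<le> nrm (U^2 - D)"
      using UD nrm_less[OF D] by (simp add: not_less[symmetric])
    moreover have "(nrm U)^2 \<le> nrm (U^2 - D)"
      using DU nrm_less[of "U^2" "U^2 - D"] U P_diff_commute[of D "U^2"]
      by (simp add: not_less[symmetric] flip: nrm_power2)
    \<comment> \<open>With norm at least both \<open>nrm D\<close> and \<open>(nrm U)^2\<close>, the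
      value \<open>U^2 - D\<close> is bounded below by their geometric mean; raising the squared
      inequality to the power \<open>-1/4\<close> gives the claim.\<close>
    ultimately have "(nrm D)^1 * (nrm U)^2 \<le> nrm (U^2 - D) * nrm (U^2 - D)"
      by (intro mult_mono) auto
    then have "(nrm (U^2 - D) * nrm (U^2 - D)) powr (- 1/4) \<le> (nrm D * (nrm U)^2) powr (- 1/4)"
      by (intro powr_mono2' mult_pos_pos zero_less_power nrm_pos D U) simp_all
    also have "(nrm D * (nrm U)^2) powr (- 1/4) = nrm D powr (- 1/4) * nrm U powr (- 1/2)"
      using nrm_pos[OF U] by (simp add: powr_mult powr_powr flip: powr_numeral)
    also have "(nrm (U^2 - D) * nrm (U^2 - D)) powr (- 1/4) = nrm (U^2 - D) powr (- 1/2)"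
      by (simp add: powr_mult flip: powr_add)
    finally have "w (U^2 - D) \<le> nrm D powr (- 1/4) * nrm U powr (- 1/2)"
      using w_le[of "U^2 - D"] by linarith
    moreover have "0 \<le> nrm D powr (- 1/4) * nrm U powr (- 1/2)" by simp
    ultimately show ?thesis unfolding distrib_left diff_zero add_0_right by linarith
  qed
  then show thesis by (rule that)
qed


text \<open>The pointwise bound \<open>w_square_diff_le\<close> is integrated: its two translated
  singularities contribute at most \<open>J\<close> each, whatever \<open>D\<close> is, so only the
  factor \<open>nrm D powr (- 1/4)\<close> remains.\<close>

lemma phi_bound:
  assumes "\<alpha> \<noteq> 0"
  obtains C where "C \<ge> 0" "\<And>D. D \<noteq> 0 \<Longrightarrow> phi m \<alpha> 0 D \<le> ennreal (C * nrm D powr (- 1/4))"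
proof -
  obtain J where J: "J \<ge> 0"
    "\<And>s. (\<integral>\<^sup>+x. indicator (P m) x * ennreal (nrm (x - s) powr (- 1/2)) \<partial>M) \<le> ennreal J"
    using translated_singular_integral_bound by blast
  define A where "A = nrm \<alpha> powr (- 1/2)"
  have A: "A \<ge> 0" by (simp add: A_def)
  have meas [measurable]: "(\<lambda>h. nrm (h - s)) \<in> borel_measurable M" for s
    using measurable_compose[OF affine_measurable[of 1 "- s"] nrm_measurable] by simp
  have "phi m \<alpha> 0 D \<le> ennreal (2 * A * J * nrm D powr (- 1/4))" if D: "D \<noteq> 0" for D
  proof -
    obtain s where s: "\<And>U. U \<noteq> 0 \<Longrightarrow> w (U^2 - D)
        \<le> nrm D powr (- 1/4) * (nrm (U - s) powr (- 1/2) + nrm (U + s) powr (- 1/2))"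
      using w_square_diff_le[OF D] by blast
    define s' where "s' = s / \<alpha>"
    define I where "I b = (\<integral>\<^sup>+h. indicator (P m) h * ennreal (nrm (h - b) powr (- 1/2)) \<partial>M)" for b
    have meas2: "(\<lambda>h. indicator (P m) h * ennreal (nrm (h - b) powr (- 1/2))) \<in> borel_measurable M" for b
      by measurable
    define E where "E = nrm D powr (- 1/4) * A"
    have E: "E \<ge> 0" using A by (simp add: E_def)
    have "w ((\<alpha> * h + 0)^2 - D) \<le> E * (nrm (h - s') powr (- 1/2) + nrm (h - (- s')) powr (- 1/2))"
      if "h \<noteq> 0" for h
    proof -
      have "\<alpha> * h - s = \<alpha> * (h - s')" "\<alpha> * h + s = \<alpha> * (h - (- s'))"
        using assms by (simp_all add: s'_def right_diff_distrib distrib_left)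
      then have n: "nrm (\<alpha> * h - s) = nrm \<alpha> * nrm (h - s')" "nrm (\<alpha> * h + s) = nrm \<alpha> * nrm (h - (- s'))"
        using nrm_mult by metis+
      have "\<alpha> * h \<noteq> 0" using assms that by simp
      from s[OF this, unfolded n] show ?thesis
        by (simp add: powr_mult E_def A_def distrib_left mult_ac)
    qed
    then have "phi m \<alpha> 0 D \<le> (\<integral>\<^sup>+h. ennreal E * (indicator (P m) h * ennreal (nrm (h - s') powr (- 1/2))
        + indicator (P m) h * ennreal (nrm (h - (- s')) powr (- 1/2))) \<partial>M)"
      unfolding phi_def using E
      by (intro nn_integral_mono_AE eventually_mono[OF AE_neq])
        (auto simp: indicator_def ennreal_leI simp flip: ennreal_mult ennreal_plus)
    also have "\<dots> = ennreal E * (I s' + I (- s'))"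
      unfolding I_def by (simp only: nn_integral_cmult nn_integral_add borel_measurable_add meas2)
    also have "\<dots> \<le> ennreal E * (ennreal J + ennreal J)"
      unfolding I_def by (intro mult_left_mono add_mono J) auto
    also have "\<dots> = ennreal (2 * A * J * nrm D powr (- 1/4))"
      using E J A by (simp add: E_def ennreal_plus[symmetric] ennreal_mult[symmetric] mult_ac del: ennreal_plus)
    finally show ?thesis .
  qed
  then show thesis using A J(1) by (intro that[of "2 * A * J"]) auto
qed

lemma phi_measurable: "phi m \<alpha> 0 \<in> borel_measurable M"
proof (rule locally_constant_measurable[of 0])
  fix D assume D: "D \<noteq> (0::'a)"
  have "phi m \<alpha> 0 D' = phi m \<alpha> 0 D" if D': "D' \<in> B D (v D + 1)" for D'
  proof -
    have "D' - D \<in> P (v D + 1)" using D' by simp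
    then obtain r where "r \<noteq> 0" "v r = 0" "D' = r^2 * D"
      by (rule near_is_square_multiple[OF D]) auto
    then show ?thesis using phi_scale[of r m \<alpha> 0 D] by simp
  qed
  then show "\<exists>k. \<forall>D'\<in>B D k. phi m \<alpha> 0 D' = phi m \<alpha> 0 D" by blast
qed

text \<open>Multiplication by \<open>(2 * a)^2\<close> completes the square and yields the
  discriminant. As this factor is a square, the weight only picks up
  \<open>nrm (2 * a)\<close>.\<close>

lemma nn_integral_quadratic:
  assumes a: "a \<noteq> 0"
  shows "(\<integral>\<^sup>+x. indicator (B x0 m) x * ennreal (w (a^2 * x^2 + b * x + c)) \<partial>M)
    = ennreal (nrm (2 * a)) * phi m (2 * a^2) (2 * a^2 * x0 + b) (b^2 - 4 * a^2 * c)"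
proof -
  have a2: "2 * a \<noteq> 0" using a two_nz by simp
  have [measurable]: "(\<lambda>x. w (a^2 * x^2 + b * x + c)) \<in> borel_measurable M"
    by (rule measurable_compose[OF quadratic_measurable w_measurable])
  have eq: "w (a^2 * (x0 + h)^2 + b * (x0 + h) + c)
      = nrm (2 * a) * w ((2 * a^2 * h + (2 * a^2 * x0 + b))^2 - (b^2 - 4 * a^2 * c))" for h
  proof -
    have "(2 * a^2 * h + (2 * a^2 * x0 + b))^2 - (b^2 - 4 * a^2 * c)
        = (2 * a)^2 * (a^2 * (x0 + h)^2 + b * (x0 + h) + c)"
      by (simp add: power2_eq_square algebra_simps)
    then show ?thesis using w_mult[OF a2] a two_nz by simp
  qed
  have "(\<integral>\<^sup>+x. indicator (B x0 m) x * ennreal (w (a^2 * x^2 + b * x + c)) \<partial>M)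
      = (\<integral>\<^sup>+h. indicator (B x0 m) (1 * h + x0) * ennreal (w (a^2 * (1 * h + x0)^2 + b * (1 * h + x0) + c)) \<partial>M)"
    by (rule nn_integral_affine[symmetric]) auto
  also have "\<dots> = (\<integral>\<^sup>+h. ennreal (nrm (2 * a)) * (indicator (P m) h *
      ennreal (w ((2 * a^2 * h + (2 * a^2 * x0 + b))^2 - (b^2 - 4 * a^2 * c)))) \<partial>M)"
    using eq by (intro nn_integral_cong) (auto simp: indicator_def add.commute simp flip: ennreal_mult)
  also have "\<dots> = ennreal (nrm (2 * a)) * phi m (2 * a^2) (2 * a^2 * x0 + b) (b^2 - 4 * a^2 * c)"
    unfolding phi_def by (rule nn_integral_cmult) measurable
  finally show ?thesis .
qed

section \<open>Integrals of a quadratic polynomial\<close>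

text \<open>The parameter \<open>a\<close> is a square root of the leading coefficient, so that the
  coefficient is a square by construction.\<close>

definition quad_int :: "'a \<Rightarrow> int \<Rightarrow> 'a \<Rightarrow> 'a \<Rightarrow> 'a \<Rightarrow> ennreal" where
  "quad_int x0 m a b c = (\<integral>\<^sup>+x. indicator (B x0 m) x * ennreal (w (a^2 * x^2 + b * x + c)) \<partial>M)"

text \<open>Near \<open>a0\<close> the quotient \<open>r = a u / a0\<close> is a unit, and
  \<open>phi_unit\<close> absorbs \<open>r^2\<close>; the slope of \<open>phi\<close> can thus be
  frozen at its limit.\<close>

lemma quad_int_eq_phi:
  assumes "vlim a a0 F" "a0 \<noteq> 0"
  shows "\<forall>\<^sub>F u in F. \<forall>b c. quad_int x0 m (a u) b c
    = ennreal (nrm (2 * a0)) * phi m (2 * a0^2) (2 * (a u)^2 * x0 + b) (b^2 - 4 * (a u)^2 * c)"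
  using vlim_nonzero[OF assms]
proof eventually_elim
  case (elim u)
  define r where "r = a u / a0"
  have r: "r \<noteq> 0" "v r = 0" "a u = a0 * r" using elim assms by (auto simp: r_def v_divide)
  have "phi m (2 * (a u)^2) C D = phi m (2 * a0^2) C D" for C D
  proof -
    have "2 * (a u)^2 = 2 * a0^2 * r^2" by (simp add: r(3) power_mult_distrib)
    moreover have "r^2 \<noteq> 0" "v (r^2) = 0" using r by (auto simp: power2_eq_square v_mult)
    ultimately show ?thesis using phi_unit[of "r^2" m "2 * a0^2" C D] by metis
  qed
  moreover have "nrm (2 * a u) = nrm (2 * a0)" using elim by (simp add: nrm_mult)
  ultimately show ?case using nn_integral_quadratic[of "a u"] elim by (simp add: quad_int_def)
qed

lemma phi_locally_constant:
  assumes "vlim g g0 F" "vlim d d0 F" "d0 \<noteq> 0" "\<alpha> \<noteq> 0"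
  shows "\<forall>\<^sub>F u in F. phi m \<alpha> (g u) (d u) = phi m \<alpha> g0 d0"
  using vlimD[OF assms(1), of "m + v \<alpha>"]
    \<comment> \<open>The relative precision makes \<open>g0 * (r - 1)\<close> fall into
      \<open>P (m + v \<alpha>)\<close>, the tolerance of \<open>phi_cong\<close>; the 1 is what the
      square root needs.\<close>
    vlimD[OF assms(2), of "v d0 + max 1 (m + v \<alpha> - v g0)"]
proof eventually_elim
  case (elim u)
  obtain r where r: "r - 1 \<in> P (max 1 (m + v \<alpha> - v g0))" "r \<noteq> 0" "v r = 0" "d u = r^2 * d0"
    by (rule near_is_square_multiple[OF assms(3) elim(2)]) auto
  have "g0 * (r - 1) \<in> P (m + v \<alpha>)"
    using P_mult[OF P_self[of g0], of "r - 1" "m + v \<alpha> - v g0"] r(1) by simp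
  from P_diff[OF elim(1) this] have "g u - g0 * r \<in> P (m + v \<alpha>)" by (simp add: algebra_simps)
  from phi_cong[OF r(2,3) assms(4) this, of d0] show ?case by (simp add: r(4))
qed

text \<open>\<open>U\<close> has no zero on the ball, so its norm is constantly
  \<open>nrm g0\<close> and \<open>U^2\<close> dominates the small discriminant; the integrand is
  the constant \<open>1 / nrm g0\<close>.\<close>

lemma phi_locally_constant_off_centre:
  assumes "vlim g g0 F" "vlim d 0 F" "\<alpha> \<noteq> 0" "g0 \<notin> P (m + v \<alpha>)"
  shows "\<exists>K. \<forall>\<^sub>F u in F. phi m \<alpha> (g u) (d u) = K"
proof
  have g0: "g0 \<noteq> 0" "v g0 < m + v \<alpha>" using assms(4) by (auto simp: vid_def)
  show "\<forall>\<^sub>F u in F. phi m \<alpha> (g u) (d u) = (\<integral>\<^sup>+h. indicator (P m) h * ennreal (1 / nrm g0) \<partial>M)"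
    using vlimD[OF assms(1), of "v g0 + 1"] vlimD[OF assms(2), of "2 * v g0 + 1"]
  proof eventually_elim
    case (elim u)
    have "w ((\<alpha> * h + g u)^2 - d u) = 1 / nrm g0" if h: "h \<in> P m" for h
    proof -
      have "\<alpha> * h \<in> P (v g0 + 1)"
        by (rule P_mono[OF _ P_mult[OF P_self h]]) (use g0 in simp)
      from P_add[OF this elim(1)] have "(\<alpha> * h + g u) - g0 \<in> P (v g0 + 1)" by (simp add: algebra_simps)
      from v_add_eq[OF g0(1) this] have U: "\<alpha> * h + g u \<noteq> 0" "v (\<alpha> * h + g u) = v g0" by auto
      then have "v ((\<alpha> * h + g u)^2) = 2 * v g0" by (simp add: power2_eq_square v_mult)
      then have "w ((\<alpha> * h + g u)^2 - d u) = w ((\<alpha> * h + g u)^2)"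
        using elim(2) U by (intro w_near) auto
      also have "\<dots> = 1 / nrm g0" using w_square[OF U(1)] nrm_eq[OF U(1) g0(1) U(2)] by simp
      finally show ?thesis .
    qed
    then show ?case unfolding phi_def by (intro nn_integral_cong) (auto simp: indicator_def)
  qed
qed

text \<open>\<open>U\<close> vanishes at \<open>- g u / \<alpha>\<close>, a point of the ball, which
  may be taken as the new centre.\<close>

lemma phi_recentre:
  assumes "vlim g g0 F" "\<alpha> \<noteq> 0" "g0 \<in> P (m + v \<alpha>)"
  shows "\<forall>\<^sub>F u in F. \<forall>D. phi m \<alpha> (g u) D = phi m \<alpha> 0 D"
  using vlimD[OF assms(1), of "m + v \<alpha>"]
proof eventually_elim
  case (elim u)
  have "g u \<in> P (m + v \<alpha>)" using P_add[OF elim assms(3)] by simp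
  then have "g u / \<alpha> \<in> P m"
    using P_mult_iff'[OF assms(2), of "g u / \<alpha>" "m + v \<alpha>"] assms(2) by simp
  from phi_shift[OF this, of \<alpha> 0] show ?case using assms(2) by simp
qed

text \<open>The leading coefficient degenerates: near the limit the polynomial is
  \<open>(x - \<rho>) (a\<^sup>2 x + \<beta>)\<close> with \<open>\<beta>\<close> close to \<open>b0\<close>, so only the root \<open>\<rho>\<close> that stays bounded matters.\<close>
lemma quad_int_locally_constant_linear:
  assumes a: "vlim a 0 F" and b: "vlim b b0 F" and c: "vlim c c0 F" and b0: "b0 \<noteq> 0"
  shows "\<exists>K. \<forall>\<^sub>F u in F. quad_int x0 m (a u) (b u) (c u) = K"
proof
  define \<rho>0 where "\<rho>0 = - c0 / b0"
  define K where "K = (\<integral>\<^sup>+x. indicator (B x0 m) x * ennreal (w ((x - \<rho>0) * b0)) \<partial>M)"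
  \<comment> \<open>Chosen so that the root \<open>\<rho>\<close> differs from
    \<open>\<rho>0\<close> by an element of \<open>P m\<close>; the translation between them then
    preserves the ball.\<close>
  define k where "k = max 1 (m + v b0 - v c0)"
  have A: "vlim (\<lambda>u. (a u)^2) 0 F" using vlim_power2[OF a] by simp
  have D: "vlim (\<lambda>u. (b u)^2 - 4 * (a u)^2 * c u) (b0^2) F"
    using vlim_diff[OF vlim_power2[OF b] vlim_mult[OF vlim_mult[OF vlim_const A] c]] by simp
  have b02: "b0^2 \<noteq> 0" using b0 by simp
  show "\<forall>\<^sub>F u in F. quad_int x0 m (a u) (b u) (c u) = K"
    using vlimD[OF A, of "v b0 + 1 - min m (v x0)"] vlimD[OF b, of "v b0 + k"]
      vlimD[OF c, of "m + v b0"] vlimD[OF D, of "v (b0^2) + k"]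
  proof eventually_elim
    case (elim u)
    have k: "k \<ge> 1" by (simp add: k_def)
    obtain r where r: "r - 1 \<in> P k" "(b u)^2 - 4 * (a u)^2 * c u = r^2 * b0^2"
      by (rule near_is_square_multiple[OF b02 elim(4) k]) auto
    \<comment> \<open>The square root of the discriminant close to \<open>b0\<close>, not
      \<open>- b0\<close>. It makes \<open>\<beta>\<close> close to \<open>b0\<close> and sends the
      other root, \<open>- \<beta> / (a u)^2\<close>, to infinity.\<close>
    define s where "s = r * b0"
    define \<beta> where "\<beta> = (b u + s) / 2"
    have s: "s^2 = (b u)^2 - 4 * (a u)^2 * c u" using r by (simp add: s_def power_mult_distrib)
    have "s - b0 \<in> P (v b0 + k)" using P_mult[OF P_self[of b0] r(1)] by (simp add: s_def algebra_simps)
    moreover have "2 * (\<beta> - b0) = (b u - b0) + (s - b0)"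
      using two_nz by (simp add: \<beta>_def right_diff_distrib)
    ultimately have "2 * (\<beta> - b0) \<in> P (v b0 + k)" using P_add[OF elim(2)] by metis
    then have \<beta>k: "\<beta> - b0 \<in> P (v b0 + k)"
      unfolding P_mult_iff'[OF two_nz] v_2 by simp
    then have \<beta>1: "\<beta> - b0 \<in> P (v b0 + 1)" by (rule P_mono[rotated]) (use k in simp)
    from v_add_eq[OF b0 this] have \<beta>: "\<beta> \<noteq> 0" "v \<beta> = v b0" by auto
    define \<rho> where "\<rho> = - c u / \<beta>"
    \<comment> \<open>\<open>\<beta>\<close> is a root of
      \<open>T^2 - b u * T + (a u)^2 * c u\<close>. Nothing is divided by \<open>a u\<close>, so
      \<open>a u = 0\<close> is permitted.\<close>
    have \<beta>q: "\<beta> * (b u - \<beta>) = (a u)^2 * c u"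
    proof -
      have "2 * \<beta> = b u + s" using two_nz by (simp add: \<beta>_def)
      moreover have "(2 * 2) * (\<beta> * (b u - \<beta>)) = (2 * \<beta>) * (2 * b u - 2 * \<beta>)"
        by (simp add: algebra_simps)
      ultimately have "(2 * 2) * (\<beta> * (b u - \<beta>)) = (b u + s) * (2 * b u - (b u + s))" by simp
      also have "\<dots> = (b u)^2 - s^2" by (simp add: power2_eq_square algebra_simps)
      also have "\<dots> = (2 * 2) * ((a u)^2 * c u)" by (simp add: s)
      finally have "(2 * 2) * (\<beta> * (b u - \<beta>)) = (2 * 2) * ((a u)^2 * c u)" .
      moreover have "(2 * 2 :: 'a) \<noteq> 0" using two_nz by (metis mult_eq_0_iff)
      ultimately show ?thesis by (metis mult_left_cancel)
    qed
    have factor: "(a u)^2 * x^2 + b u * x + c u = (x - \<rho>) * ((a u)^2 * x + \<beta>)" for x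
    proof -
      have "\<beta> * ((a u)^2 * x^2 + b u * x + c u)
          = (\<beta> * x + c u) * ((a u)^2 * x + \<beta>) + x * (\<beta> * (b u - \<beta>) - (a u)^2 * c u)"
        by (simp add: power2_eq_square algebra_simps)
      also have "\<dots> = \<beta> * ((x - \<rho>) * ((a u)^2 * x + \<beta>))"
        using \<beta>(1) \<beta>q by (simp add: \<rho>_def field_simps)
      finally show ?thesis using \<beta>(1) by simp
    qed
    have weq: "w ((a u)^2 * x^2 + b u * x + c u) = w ((x - \<rho>) * b0)" if x: "x \<in> B x0 m" for x
    proof (cases "x = \<rho>")
      case False
      have "x - x0 \<in> P (min m (v x0))" "x0 \<in> P (min m (v x0))"
        using x by (auto intro: P_mono[OF _ P_self] P_mono[of _ m])
      from P_add[OF this] have "x \<in> P (min m (v x0))" by simp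
      from P_mult[OF _ this, of "(a u)^2" "v b0 + 1 - min m (v x0)"]
      have "(a u)^2 * x \<in> P (v b0 + 1)" using elim(1) by simp
      from P_add[OF this \<beta>1] have "((a u)^2 * x + \<beta>) - b0 \<in> P (v b0 + 1)" by (simp add: algebra_simps)
      from P_mult[OF P_self[of "x - \<rho>"] this]
      have "(x - \<rho>) * ((a u)^2 * x + \<beta>) - (x - \<rho>) * b0 \<in> P (v ((x - \<rho>) * b0) + 1)"
        using False b0 by (simp add: right_diff_distrib[symmetric] v_mult add_ac)
      then show ?thesis unfolding factor by (rule w_near[rotated]) (use False b0 in simp)
    qed (simp add: factor)
    have meas: "(\<lambda>x. w ((x - \<rho>0) * b0)) \<in> borel_measurable M"
    proof -
      have "(\<lambda>x. (x - \<rho>0) * b0) \<in> measurable M M"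
        by (intro continuous_measurable vlim_intros)
      then show ?thesis by (rule measurable_compose) simp
    qed
    have "\<rho>0 - \<rho> \<in> P m"
    proof -
      have "c0 * (\<beta> - b0) \<in> P (m + 2 * v b0)"
        by (rule P_mono[OF _ P_mult[OF P_self \<beta>k]]) (simp add: k_def)
      moreover have "(c u - c0) * b0 \<in> P (m + 2 * v b0)"
        using P_mult[OF elim(3) P_self[of b0]] by (simp add: add_ac)
      ultimately have "(c u - c0) * b0 - c0 * (\<beta> - b0) \<in> P (m + 2 * v b0)" by (intro P_diff)
      moreover have "(c u - c0) * b0 - c0 * (\<beta> - b0) = (b0 * \<beta>) * (\<rho>0 - \<rho>)"
        using \<beta>(1) b0 by (simp add: \<rho>_def \<rho>0_def field_simps)
      ultimately show ?thesis
        using P_mult_iff'[of "b0 * \<beta>" "\<rho>0 - \<rho>"] \<beta> b0 by (simp add: v_mult)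
    qed
    then have ind: "1 * x + (\<rho>0 - \<rho>) \<in> B x0 m \<longleftrightarrow> x \<in> B x0 m" for x
      using P_add_iff[of "\<rho>0 - \<rho>" m "x - x0"] by (simp add: algebra_simps)
    have "K = (\<integral>\<^sup>+x. indicator (B x0 m) (1 * x + (\<rho>0 - \<rho>)) * ennreal (w ((1 * x + (\<rho>0 - \<rho>) - \<rho>0) * b0)) \<partial>M)"
      unfolding K_def using meas by (intro nn_integral_affine[symmetric]) auto
    also have "\<dots> = (\<integral>\<^sup>+x. indicator (B x0 m) x * ennreal (w ((x - \<rho>) * b0)) \<partial>M)"
      unfolding indicator_def ind by (simp add: algebra_simps)
    also have "\<dots> = quad_int x0 m (a u) (b u) (c u)"
      unfolding quad_int_def using weq by (intro nn_integral_cong) (auto simp: indicator_def)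
    finally show ?case by simp
  qed
qed

lemma quad_int_locally_constant_nonzero:
  assumes a: "vlim a 0 F" and b: "vlim b 0 F" and c: "vlim c c0 F" and c0: "c0 \<noteq> 0"
  shows "\<exists>K. \<forall>\<^sub>F u in F. quad_int x0 m (a u) (b u) (c u) = K"
proof
  define j where "j = min m (v x0)"
  have A: "vlim (\<lambda>u. (a u)^2) 0 F" using vlim_power2[OF a] by simp
  show "\<forall>\<^sub>F u in F. quad_int x0 m (a u) (b u) (c u)
      = (\<integral>\<^sup>+x. indicator (B x0 m) x * ennreal (w c0) \<partial>M)"
    using vlimD[OF A, of "v c0 + 1 - 2 * j"] vlimD[OF b, of "v c0 + 1 - j"] vlimD[OF c, of "v c0 + 1"]
  proof eventually_elim
    case (elim u)
    have "w ((a u)^2 * x^2 + b u * x + c u) = w c0" if x: "x \<in> B x0 m" for x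
    proof -
      have "x - x0 \<in> P j" "x0 \<in> P j"
        using x by (auto simp: j_def intro: P_mono[OF _ P_self] P_mono[of _ m])
      from P_add[OF this] have x: "x \<in> P j" by simp
      have "(a u)^2 * (x * x) \<in> P (v c0 + 1)"
        using P_mult[OF _ P_mult[OF x x], of "(a u)^2" "v c0 + 1 - 2 * j"] elim(1) by simp
      moreover have "b u * x \<in> P (v c0 + 1)"
        using P_mult[OF _ x, of "b u" "v c0 + 1 - j"] elim(2) by simp
      ultimately have "(a u)^2 * (x * x) + b u * x + (c u - c0) \<in> P (v c0 + 1)"
        using elim(3) by (intro P_add)
      then show ?thesis by (intro w_near c0) (simp add: power2_eq_square algebra_simps)
    qed
    then show ?case unfolding quad_int_def by (intro nn_integral_cong) (auto simp: indicator_def)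
  qed
qed

text \<open>The exponent is that of \<open>phi_bound\<close>; its double, \<open>-1/2\<close>, is
  still integrable at a point. The centre is excluded because \<open>0 powr _ = 0\<close>.\<close>

definition tame :: "'a \<Rightarrow> int \<Rightarrow> ('a \<Rightarrow> real) \<Rightarrow> bool" where
  "tame a N g \<longleftrightarrow> g \<in> borel_measurable M \<and>
    (\<exists>C. \<forall>y\<in>B a N. y \<noteq> a \<longrightarrow> \<bar>g y\<bar> \<le> C * nrm (y - a) powr (- 1/4))"

lemma tame_mono: "tame a N g \<Longrightarrow> N \<le> N' \<Longrightarrow> tame a N' g"
  unfolding tame_def using P_mono by blast

lemma tame_const: "tame a N (\<lambda>_. c)"
proof -
  have "\<bar>c\<bar> \<le> (\<bar>c\<bar> * real q powr (- N / 4)) * nrm (y - a) powr (- 1/4)" if y: "y \<in> B a N" "y \<noteq> a" for y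
  proof -
    have "real q powr (N / 4) \<le> nrm (y - a) powr (- 1/4)"
      using y q_gt_1 by (auto simp: nrm_powr vid_def powr_le_cancel_iff)
    then have "real q powr (- N / 4) * real q powr (N / 4) \<le> real q powr (- N / 4) * nrm (y - a) powr (- 1/4)"
      by (intro mult_left_mono) auto
    also have "real q powr (- N / 4) * real q powr (N / 4) = 1"
      using q_gt_1 by (simp flip: powr_add)
    finally have "\<bar>c\<bar> * 1 \<le> \<bar>c\<bar> * (real q powr (- N / 4) * nrm (y - a) powr (- 1/4))"
      by (intro mult_left_mono) auto
    then show ?thesis by (simp add: mult_ac)
  qed
  then show ?thesis unfolding tame_def by auto
qed

text \<open>The polynomial \<open>e\<close> of the overview; its zeros are the finite parabolic
  points.\<close>

definition cubic :: "'a \<Rightarrow> 'a \<Rightarrow> 'a" where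
  "cubic t y = y * (y - 1) * (y - t)"

lemma vlim_if:
  "vlim g l F \<Longrightarrow> vlim h l' F \<Longrightarrow> vlim (\<lambda>u. if Q then g u else h u) (if Q then l else l') F"
  by simp

lemma vlim_cubic: "vlim g l F \<Longrightarrow> vlim (\<lambda>u. cubic t (g u)) (cubic t l) F"
  unfolding cubic_def by (intro vlim_intros)

text \<open>The hypotheses on \<open>t\<close> make 0, 1, \<open>t\<close> distinct, so the cofactor
  of \<open>y - a\<close> is nonzero at \<open>a\<close> and has constant norm nearby.\<close>

lemma cubic_simple_zero:
  assumes t: "t \<noteq> 0" "t \<noteq> 1" and e: "cubic t a = 0"
  obtains \<gamma> where "\<gamma> > 0" "\<forall>\<^sub>F y in nb a. nrm (cubic t y) = nrm (y - a) * \<gamma>"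
proof -
  define s where "s y = (if a = 0 then (y - 1) * (y - t) else if a = 1 then y * (y - t) else y * (y - 1))" for y
  have a: "a \<in> {0, 1, t}" using e by (auto simp: cubic_def)
  have f: "cubic t y = (y - a) * s y" for y using a by (auto simp: cubic_def s_def)
  have sa: "s a \<noteq> 0" using a t by (auto simp: s_def)
  have "vlim s (s a) (nb a)"
    unfolding s_def by (intro vlim_if vlim_intros)
  from vlim_nonzero[OF this sa] have "\<forall>\<^sub>F y in nb a. nrm (cubic t y) = nrm (y - a) * nrm (s a)"
    by eventually_elim (simp add: f nrm_mult)
  with nrm_pos[OF sa] show thesis by (rule that)
qed

lemma tame_phi:
  assumes t: "t \<noteq> 0" "t \<noteq> 1" and e: "cubic t a = 0" and "\<alpha> \<noteq> 0" "\<delta> \<noteq> 0" "\<kappa> \<ge> 0"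
  obtains N where "tame a N (\<lambda>y. enn2real (ennreal \<kappa> * phi m \<alpha> 0 (\<delta> * cubic t y)))"
proof -
  obtain C where C: "C \<ge> 0" "\<And>D. D \<noteq> 0 \<Longrightarrow> phi m \<alpha> 0 D \<le> ennreal (C * nrm D powr (- 1/4))"
    using phi_bound[OF assms(4)] by blast
  obtain \<gamma> where \<gamma>: "\<gamma> > 0" "\<forall>\<^sub>F y in nb a. nrm (cubic t y) = nrm (y - a) * \<gamma>"
    using cubic_simple_zero[OF t e] by blast
  then obtain N where N: "\<forall>y\<in>B a N. nrm (cubic t y) = nrm (y - a) * \<gamma>" by (auto simp: eventually_nb)
  have meas: "(\<lambda>y. phi m \<alpha> 0 (\<delta> * cubic t y)) \<in> borel_measurable M"
  proof (rule measurable_compose[OF _ phi_measurable])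
    show "(\<lambda>y. \<delta> * cubic t y) \<in> measurable M M"
      by (rule continuous_measurable) (intro vlim_mult vlim_const vlim_cubic vlim_ident)
  qed
  have "\<bar>enn2real (ennreal \<kappa> * phi m \<alpha> 0 (\<delta> * cubic t y))\<bar>
      \<le> (\<kappa> * C * (nrm \<delta> * \<gamma>) powr (- 1/4)) * nrm (y - a) powr (- 1/4)"
    if y: "y \<in> B a N" "y \<noteq> a" for y
  proof -
    have n: "nrm (\<delta> * cubic t y) = (nrm \<delta> * \<gamma>) * nrm (y - a)"
      using bspec[OF N y(1)] by (simp add: nrm_mult mult_ac)
    have "nrm (\<delta> * cubic t y) > 0" unfolding n using nrm_pos \<gamma> y assms by simp
    then have nz: "\<delta> * cubic t y \<noteq> 0" by auto
    have "ennreal \<kappa> * phi m \<alpha> 0 (\<delta> * cubic t y) \<le> ennreal \<kappa> * ennreal (C * nrm (\<delta> * cubic t y) powr (- 1/4))"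
      by (intro mult_left_mono C nz) simp
    also have "\<dots> = ennreal (\<kappa> * (C * nrm (\<delta> * cubic t y) powr (- 1/4)))"
      using assms C by (simp add: ennreal_mult)
    finally have "enn2real (ennreal \<kappa> * phi m \<alpha> 0 (\<delta> * cubic t y)) \<le> \<kappa> * (C * nrm (\<delta> * cubic t y) powr (- 1/4))"
      using assms C by (intro enn2real_leI) auto
    then show ?thesis unfolding n using \<gamma> by (simp add: powr_mult mult_ac)
  qed
  then have "tame a N (\<lambda>y. enn2real (ennreal \<kappa> * phi m \<alpha> 0 (\<delta> * cubic t y)))"
    unfolding tame_def using meas by auto
  then show thesis by (rule that)
qed

text \<open>The case distinction follows the discriminant \<open>b\<^sup>2 - 4 a\<^sup>2 c\<close>: where it does not vanish the
  integral is locally constant; where it vanishes because of one of the two variables only, the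
  integral depends on that variable alone.\<close>
lemma quad_int_local_product:
  fixes a b c :: "'a \<Rightarrow> 'a \<Rightarrow> 'a" and y0 z0 :: 'a
  defines "F \<equiv> nb y0 \<times>\<^sub>F nb z0"
  assumes t: "t \<noteq> 0" "t \<noteq> 1" and \<kappa>: "\<kappa> \<noteq> 0"
    and va: "vlim (\<lambda>u. a (fst u) (snd u)) (a y0 z0) F"
    and vb: "vlim (\<lambda>u. b (fst u) (snd u)) (b y0 z0) F"
    and vc: "vlim (\<lambda>u. c (fst u) (snd u)) (c y0 z0) F"
    and disc: "\<And>y z. (b y z)^2 - 4 * (a y z)^2 * c y z = \<kappa> * cubic t y * cubic t z"
    and a0: "a y0 z0 = 0 \<Longrightarrow> cubic t y0 = 0 \<longleftrightarrow> cubic t z0 = 0"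
    and nz: "\<And>x. x \<in> B x0 m \<Longrightarrow> cubic t y0 = 0 \<Longrightarrow> cubic t z0 = 0 \<Longrightarrow>
      (a y0 z0)^2 * x^2 + b y0 z0 * x + c y0 z0 \<noteq> 0"
  obtains N g h where "tame y0 N g" "tame z0 N h"
    "\<And>y z. y \<in> B y0 N \<Longrightarrow> z \<in> B z0 N \<Longrightarrow> enn2real (quad_int x0 m (a y z) (b y z) (c y z)) = g y * h z"
proof -
  note product = that
  let ?I = "\<lambda>u. quad_int x0 m (a (fst u) (snd u)) (b (fst u) (snd u)) (c (fst u) (snd u))"
  have const: thesis if ex: "\<exists>K. \<forall>\<^sub>F u in F. ?I u = K"
  proof -
    obtain K where "\<forall>\<^sub>F u in F. ?I u = K" using ex by blast
    then obtain N where "\<And>y z. y \<in> B y0 N \<Longrightarrow> z \<in> B z0 N \<Longrightarrow> ?I (y, z) = K"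
      unfolding F_def by (rule eventually_nb_prodE) blast
    then show thesis
      by (intro product[of N "\<lambda>_. enn2real K" "\<lambda>_. 1"] tame_const) auto
  qed
  define D where "D u = (b (fst u) (snd u))^2 - 4 * (a (fst u) (snd u))^2 * c (fst u) (snd u)" for u
  define D0 where "D0 = \<kappa> * cubic t y0 * cubic t z0"
  have D0: "D0 = (b y0 z0)^2 - 4 * (a y0 z0)^2 * c y0 z0" by (simp add: D0_def disc)
  have vD: "vlim D D0 F"
    unfolding D_def D0 by (intro vlim_intros va vb vc)
  show thesis
  proof (cases "a y0 z0 = 0")
    case a00: True
    show thesis
    proof (cases "b y0 z0 = 0")
      case False
      show thesis
        by (rule const, rule quad_int_locally_constant_linear[OF _ vb vc False]) (use va a00 in simp)
    next
      case b00: True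
      \<comment> \<open>With \<open>a\<close> and \<open>b\<close> zero the discriminant vanishes,
        so one cubic factor does, and by \<open>a0\<close> both do. Then the polynomial is just its
        constant term, which \<open>nz\<close> at the point \<open>x0\<close> shows to be
        nonzero.\<close>
      have "cubic t y0 = 0 \<or> cubic t z0 = 0" using D0 a00 b00 \<kappa> by (simp add: D0_def)
      then have "cubic t y0 = 0" "cubic t z0 = 0" using a0[OF a00] by auto
      from nz[OF _ this, of x0] have c00: "c y0 z0 \<noteq> 0" using a00 b00 by simp
      show thesis
        by (rule const, rule quad_int_locally_constant_nonzero[OF _ _ vc c00]) (use va vb a00 b00 in simp_all)
    qed
  next
    case a00: False
    define \<alpha> where "\<alpha> = 2 * (a y0 z0)^2"
    define \<kappa>' where "\<kappa>' = nrm (2 * a y0 z0)"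
    define g where "g u = 2 * (a (fst u) (snd u))^2 * x0 + b (fst u) (snd u)" for u
    define g0 where "g0 = \<alpha> * x0 + b y0 z0"
    have \<alpha>: "\<alpha> \<noteq> 0" using a00 two_nz by (simp add: \<alpha>_def)
    have vg: "vlim g g0 F" unfolding g_def g0_def \<alpha>_def by (intro vlim_intros va vb)
    have I: "\<forall>\<^sub>F u in F. ?I u = ennreal \<kappa>' * phi m \<alpha> (g u) (D u)"
      using quad_int_eq_phi[OF va a00, of x0 m]
      by eventually_elim (simp add: \<kappa>'_def \<alpha>_def g_def D_def)
    have const': thesis if ex: "\<exists>K. \<forall>\<^sub>F u in F. phi m \<alpha> (g u) (D u) = K"
    proof -
      obtain K where "\<forall>\<^sub>F u in F. phi m \<alpha> (g u) (D u) = K" using ex by blast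
      with I have "\<forall>\<^sub>F u in F. ?I u = ennreal \<kappa>' * K" by eventually_elim simp
      then show thesis using const by blast
    qed
    show thesis
    proof (cases "D0 = 0")
      case False
      show thesis by (rule const') (use phi_locally_constant[OF vg vD False \<alpha>] in blast)
    next
      case D00: True
      show thesis
      proof (cases "g0 \<in> P (m + v \<alpha>)")
        case False
        show thesis
          by (rule const', rule phi_locally_constant_off_centre[OF vg _ \<alpha> False]) (use vD D00 in simp)
      next
        case g00: True
        \<comment> \<open>The double root of the limit polynomial. It lies in the ball, so
          \<open>nz\<close> forbids both cubic factors to vanish, while \<open>D0 = 0\<close> forces
          one of them to.\<close>
        define x1 where "x1 = x0 - g0 / \<alpha>"
        have "g0 / \<alpha> \<in> P m" using P_mult_iff'[OF \<alpha>, of "g0 / \<alpha>" "m + v \<alpha>"] g00 \<alpha> by simp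
        then have x1: "x1 \<in> B x0 m" by (simp add: x1_def)
        have "\<alpha> * x1 + b y0 z0 = 0" using \<alpha> by (simp add: x1_def g0_def field_simps)
        moreover have "(2 * a y0 z0)^2 * ((a y0 z0)^2 * x1^2 + b y0 z0 * x1 + c y0 z0)
            = (\<alpha> * x1 + b y0 z0)^2 - D0"
          unfolding D0 \<alpha>_def by (simp add: power2_eq_square algebra_simps)
        ultimately have "(2 * a y0 z0)^2 * ((a y0 z0)^2 * x1^2 + b y0 z0 * x1 + c y0 z0) = 0"
          using D00 by simp
        then have root: "(a y0 z0)^2 * x1^2 + b y0 z0 * x1 + c y0 z0 = 0"
          using a00 two_nz by (metis mult_eq_0_iff power2_eq_square)
        have I0: "\<forall>\<^sub>F u in F. ?I u = ennreal \<kappa>' * phi m \<alpha> 0 (D u)"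
          using I phi_recentre[OF vg \<alpha> g00] by eventually_elim simp
        have Dcub: "D u = \<kappa> * cubic t (fst u) * cubic t (snd u)" for u by (simp add: D_def disc)
        have vy: "vlim (\<lambda>u. cubic t (fst u)) (cubic t y0) F" and vz: "vlim (\<lambda>u. cubic t (snd u)) (cubic t z0) F"
          unfolding F_def by (intro vlim_cubic vlim_fst vlim_snd)+
        \<comment> \<open>A factor of the discriminant with nonzero limit may be frozen at that
          limit, being a unit square multiple of it. The statement holds for all
          \<open>\<delta>\<close> at once, so the other factor is free to vary and to
          vanish.\<close>
        have absorb: "\<forall>\<^sub>F u in F. \<forall>\<delta>. phi m \<alpha> 0 (f u * \<delta>) = phi m \<alpha> 0 (f0 * \<delta>)"
          if f: "vlim f f0 F" "f0 \<noteq> 0" for f f0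
          using vlimD[OF f(1), of "v f0 + 1"]
        proof eventually_elim
          case (elim u)
          obtain r where "r \<noteq> 0" "v r = 0" "f u = r^2 * f0"
            by (rule near_is_square_multiple[OF f(2) elim]) auto
          then show ?case using phi_scale[of r m \<alpha> 0] by (simp add: mult.assoc)
        qed
        have \<kappa>': "\<kappa>' \<ge> 0" by (simp add: \<kappa>'_def)
        consider "cubic t y0 = 0" "cubic t z0 \<noteq> 0" | "cubic t z0 = 0" "cubic t y0 \<noteq> 0"
          using D00 \<kappa> nz[OF x1] root by (auto simp: D0_def)
        then show thesis
        proof cases
          case 1
          define \<delta> where "\<delta> = \<kappa> * cubic t z0"
          have "\<delta> \<noteq> 0" using 1 \<kappa> by (simp add: \<delta>_def)
          then obtain N1 where N1: "tame y0 N1 (\<lambda>y. enn2real (ennreal \<kappa>' * phi m \<alpha> 0 (\<delta> * cubic t y)))"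
            using tame_phi[OF t 1(1) \<alpha> _ \<kappa>'] by blast
          have "\<forall>\<^sub>F u in F. ?I u = ennreal \<kappa>' * phi m \<alpha> 0 (\<delta> * cubic t (fst u))"
            using I0 absorb[OF vz 1(2)]
          proof eventually_elim
            case (elim u)
            have "D u = cubic t (snd u) * (\<kappa> * cubic t (fst u))" by (simp add: Dcub)
            moreover have "\<delta> * cubic t (fst u) = cubic t z0 * (\<kappa> * cubic t (fst u))" by (simp add: \<delta>_def)
            ultimately show ?case using elim by metis
          qed
          then obtain N2 where N2: "\<And>y z. y \<in> B y0 N2 \<Longrightarrow> z \<in> B z0 N2 \<Longrightarrow>
              ?I (y, z) = ennreal \<kappa>' * phi m \<alpha> 0 (\<delta> * cubic t (fst (y, z)))"
            unfolding F_def by (rule eventually_nb_prodE) blast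
          show thesis
          proof (rule product[of "max N1 N2"])
            show "tame y0 (max N1 N2) (\<lambda>y. enn2real (ennreal \<kappa>' * phi m \<alpha> 0 (\<delta> * cubic t y)))"
              using N1 by (rule tame_mono) simp
            show "tame z0 (max N1 N2) (\<lambda>_. 1)" by (rule tame_const)
          qed (use N2 in simp)
        next
          case 2
          define \<delta> where "\<delta> = \<kappa> * cubic t y0"
          have "\<delta> \<noteq> 0" using 2 \<kappa> by (simp add: \<delta>_def)
          then obtain N1 where N1: "tame z0 N1 (\<lambda>z. enn2real (ennreal \<kappa>' * phi m \<alpha> 0 (\<delta> * cubic t z)))"
            using tame_phi[OF t 2(1) \<alpha> _ \<kappa>'] by blast
          have "\<forall>\<^sub>F u in F. ?I u = ennreal \<kappa>' * phi m \<alpha> 0 (\<delta> * cubic t (snd u))"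
            using I0 absorb[OF vy 2(2)]
          proof eventually_elim
            case (elim u)
            have "D u = cubic t (fst u) * (\<kappa> * cubic t (snd u))" by (simp add: Dcub)
            moreover have "\<delta> * cubic t (snd u) = cubic t y0 * (\<kappa> * cubic t (snd u))" by (simp add: \<delta>_def)
            ultimately show ?case using elim by metis
          qed
          then obtain N2 where N2: "\<And>y z. y \<in> B y0 N2 \<Longrightarrow> z \<in> B z0 N2 \<Longrightarrow>
              ?I (y, z) = ennreal \<kappa>' * phi m \<alpha> 0 (\<delta> * cubic t (snd (y, z)))"
            unfolding F_def by (rule eventually_nb_prodE) blast
          show thesis
          proof (rule product[of "max N1 N2"])
            show "tame y0 (max N1 N2) (\<lambda>_. 1)" by (rule tame_const)
            show "tame z0 (max N1 N2) (\<lambda>z. enn2real (ennreal \<kappa>' * phi m \<alpha> 0 (\<delta> * cubic t z)))"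
              using N1 by (rule tame_mono) simp
          qed (use N2 in simp)
        qed
      qed
    qed
  qed
qed

section \<open>The two charts\<close>

text \<open>The first chart covers finite \<open>y\<close>; the second one covers \<open>y\<close> near infinity through the
  substitution \<open>t / y\<close>, which permutes the parabolic points.\<close>

lemma f_t_quadratic:
  "f_t t x y z = (y - z)^2 * x^2 + (2 * (t - z * y) * (y - z) - 4 * (z - t) * (z - 1) * y) * x + (t - z * y)^2"
  for t x y z :: 'a
  unfolding f_t_def by algebra

text \<open>Clearing denominators by the square \<open>y^2\<close> leaves a leading coefficient that
  is again a square, as \<open>quad_int\<close> demands.\<close>

lemma f_t_infinity_quadratic:
  fixes t x y z :: 'a
  assumes "y \<noteq> 0"
  shows "y^2 * f_t t x (t / y) z = (t - z * y)^2 * x^2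
    + (2 * (t - z * y) * (t * (y - z)) - 4 * t * (z - t) * (z - 1) * y) * x + (t * (y - z))^2"
proof -
  \<comment> \<open>Written so that the quotient survives only inside \<open>y * (t / y)\<close>:
    the ring identity treats \<open>t / y\<close> as an atom, and the product is then replaced by
    \<open>t\<close>.\<close>
  have "y^2 * f_t t x (t / y) z
      = (t * y + x * (y * (t / y)) - z * x * y - z * (y * (t / y)))^2 - 4 * (z - t) * (z - 1) * x * y * (y * (t / y))"
    unfolding f_t_def by algebra
  also have "y * (t / y) = t" using assms by simp
  finally show ?thesis by algebra
qed

lemma f_t_swap_infinity:
  fixes t x y z :: 'a
  assumes "y \<noteq> 0" "z \<noteq> 0"
  shows "(y * z)^2 * f_t t x (t / y) (t / z) = t^2 * f_t t x y z"
proof -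
  have "(y * z)^2 * f_t t x (t / y) (t / z)
      = (t * y * z + x * z * (y * (t / y)) - (z * (t / z)) * x * y - (z * (t / z)) * (y * (t / y)))^2
        - 4 * ((z * (t / z)) - t * z) * ((z * (t / z)) - z) * x * y * (y * (t / y))"
    unfolding f_t_def by algebra
  also have "y * (t / y) = t" using assms by simp
  also have "z * (t / z) = t" using assms by simp
  finally show ?thesis unfolding f_t_def by algebra
qed

lemma f_t_commute: "f_t t x y z = f_t t x z y" for t x y z :: 'a
  unfolding f_t_def by algebra

section \<open>Separable kernels\<close>

definition sq_int :: "('a \<Rightarrow> real) \<Rightarrow> bool" where
  "sq_int g \<longleftrightarrow> g \<in> borel_measurable M \<and> integrable M (\<lambda>x. (g x)^2)"

lemma sq_int_zero: "sq_int (\<lambda>_. 0)"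
  by (simp add: sq_int_def)

lemma sq_int_cmult: "sq_int g \<Longrightarrow> sq_int (\<lambda>x. c * g x)"
  by (auto simp: sq_int_def power_mult_distrib)

lemma sq_int_indicator: "sq_int g \<Longrightarrow> S \<in> sets M \<Longrightarrow> sq_int (\<lambda>x. indicator S x * g x)"
proof -
  assume g: "sq_int g" and S [measurable]: "S \<in> sets M"
  have [measurable]: "g \<in> borel_measurable M" using g by (simp add: sq_int_def)
  have "integrable M (\<lambda>x. (indicator S x * g x)^2)"
    by (rule Bochner_Integration.integrable_bound[of M "\<lambda>x. (g x)^2"])
      (use g in \<open>auto simp: sq_int_def indicator_def\<close>)
  then show ?thesis by (simp add: sq_int_def)
qed

lemma sq_int_tame:
  assumes "tame a N g"
  shows "sq_int (\<lambda>y. indicator (B a N) y * g y)"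
proof -
  obtain C where [measurable]: "g \<in> borel_measurable M"
    and C: "\<And>y. y \<in> B a N \<Longrightarrow> y \<noteq> a \<Longrightarrow> \<bar>g y\<bar> \<le> C * nrm (y - a) powr (- 1/4)"
    using assms by (auto simp: tame_def)
  have [measurable]: "(\<lambda>y. nrm (y - a)) \<in> borel_measurable M"
    using measurable_compose[OF affine_measurable[of 1 "- a"] nrm_measurable] by simp
  let ?h = "\<lambda>x. indicator (P N) x * ennreal (nrm x powr (- 1/2))"
  have "(\<integral>\<^sup>+y. ennreal (norm ((indicator (B a N) y * g y)^2)) \<partial>M)
      \<le> (\<integral>\<^sup>+y. ennreal (C^2) * ?h (1 * y + (- a)) \<partial>M)"
  proof (intro nn_integral_mono_AE eventually_mono[OF AE_neq[of a]])
    fix y assume y: "y \<noteq> a"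
    show "ennreal (norm ((indicator (B a N) y * g y)^2)) \<le> ennreal (C^2) * ?h (1 * y + (- a))"
    proof (cases "y \<in> B a N")
      case True
      have "(g y)^2 \<le> (C * nrm (y - a) powr (- 1/4))^2"
        using power_mono[OF C[OF True y], of 2] by simp
      also have "\<dots> = C^2 * nrm (y - a) powr (- 1/2)"
        by (simp add: power_mult_distrib power2_eq_square flip: powr_add)
      finally show ?thesis using True by (simp add: ennreal_leI flip: ennreal_mult)
    qed simp
  qed
  also have "\<dots> = ennreal (C^2) * (\<integral>\<^sup>+y. ?h (1 * y + (- a)) \<partial>M)"
    by (rule nn_integral_cmult) measurable
  also have "(\<integral>\<^sup>+y. ?h (1 * y + (- a)) \<partial>M) = (\<integral>\<^sup>+y. ?h y \<partial>M)"
    by (rule nn_integral_affine) auto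
  also have "ennreal (C^2) * (\<integral>\<^sup>+y. ?h y \<partial>M) < \<infinity>"
    using finite_singular_integral[of N] by (simp add: ennreal_mult_less_top)
  finally have "integrable M (\<lambda>y. (indicator (B a N) y * g y)^2)"
    by (intro integrableI_bounded) auto
  then show ?thesis by (simp add: sq_int_def)
qed

text \<open>A neighbourhood of infinity with the point itself omitted; 0 must be excluded by hand
  since \<open>t / 0 = 0\<close>.\<close>

definition E :: "'a \<Rightarrow> int \<Rightarrow> 'a set" where
  "E t N = {y. y \<noteq> 0 \<and> t / y \<in> P N}"

lemma E_sets [measurable]: "E t N \<in> sets M"
proof -
  have "(\<lambda>y. t / y) -` P N \<inter> space M \<in> sets M"
    by (rule measurable_sets[OF divide_measurable]) simp
  moreover have "E t N = ((\<lambda>y. t / y) -` P N \<inter> space M) - {0}" by (auto simp: E_def)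
  ultimately show ?thesis by simp
qed

lemma E_mono: "N \<le> N' \<Longrightarrow> E t N' \<subseteq> E t N"
  using P_mono by (auto simp: E_def)

lemma compl_E: "t \<noteq> 0 \<Longrightarrow> y \<notin> E t N \<Longrightarrow> y \<in> P (v t - N + 1)"
  by (auto simp: E_def vid_def v_divide)

text \<open>Up to a constant, \<open>nrm (t / y)\<close> is the factor by which half-densities
  transform under \<open>y \<mapsto> t / y\<close>. It makes the square decay like
  \<open>nrm y powr (- 3/2)\<close>.\<close>

lemma sq_int_tame_infinity:
  assumes t: "t \<noteq> 0" and g: "tame 0 N g"
  shows "sq_int (\<lambda>y. indicator (E t N) y * (nrm (t / y) * g (t / y)))"
proof -
  obtain C where gm: "g \<in> borel_measurable M"
    and C: "\<And>y. y \<in> B 0 N \<Longrightarrow> y \<noteq> 0 \<Longrightarrow> \<bar>g y\<bar> \<le> C * nrm (y - 0) powr (- 1/4)"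
    using g by (auto simp: tame_def)
  have [measurable]: "(\<lambda>y. g (t / y)) \<in> borel_measurable M" "(\<lambda>y. nrm (t / y)) \<in> borel_measurable M"
    by (rule measurable_compose[OF divide_measurable gm], rule measurable_compose[OF divide_measurable nrm_measurable])
  let ?S = "{x. v x \<le> v t - N} - {0}"
  let ?k = "C^2 * nrm t powr (3/2)"
  let ?h = "\<lambda>y. indicator ?S y * ennreal (nrm y powr (- 3/2))"
  have "?S = E t N" using t by (auto simp: E_def vid_def v_divide)
  then have S [measurable]: "?S \<in> sets M" by simp
  have "(\<integral>\<^sup>+y. ennreal (norm ((indicator (E t N) y * (nrm (t / y) * g (t / y)))^2)) \<partial>M)
      \<le> (\<integral>\<^sup>+y. ennreal ?k * ?h y \<partial>M)"
  proof (rule nn_integral_mono)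
    fix y
    show "ennreal (norm ((indicator (E t N) y * (nrm (t / y) * g (t / y)))^2)) \<le> ennreal ?k * ?h y"
    proof (cases "y \<in> E t N")
      case True
      then have y: "y \<noteq> 0" "y \<in> ?S" and ty: "t / y \<in> B 0 N" "t / y \<noteq> 0"
        using \<open>?S = E t N\<close> t by (auto simp: E_def)
      have "(g (t / y))^2 \<le> (C * nrm (t / y) powr (- 1/4))^2"
        using power_mono[OF C[OF ty], of 2] by simp
      also have "\<dots> = C^2 * nrm (t / y) powr (- 1/2)"
        by (simp add: power_mult_distrib power2_eq_square flip: powr_add)
      finally have "(nrm (t / y) * g (t / y))^2 \<le> (nrm (t / y))^2 * (C^2 * nrm (t / y) powr (- 1/2))"
        by (simp add: power_mult_distrib mult_left_mono)
      also have "(nrm (t / y))^2 = nrm (t / y) powr 2"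
        using nrm_pos[OF ty(2)] by (simp add: powr_numeral)
      also have "nrm (t / y) powr 2 * (C^2 * nrm (t / y) powr (- 1/2)) = C^2 * nrm (t / y) powr (3/2)"
        by (simp only: mult.left_commute[of _ "C^2"] powr_add[symmetric]) simp
      also have "nrm (t / y) powr (3/2) = nrm t powr (3/2) * nrm y powr (- 3/2)"
      proof -
        have "nrm y powr (- 3/2) = inverse (nrm y powr (3/2))"
          using powr_minus[of "nrm y" "3/2"] by simp
        moreover have "nrm (t / y) powr (3/2) = nrm t powr (3/2) / nrm y powr (3/2)"
          by (simp add: nrm_divide powr_divide)
        ultimately show ?thesis by (metis divide_inverse)
      qed
      finally show ?thesis using True y by (simp add: mult.assoc ennreal_leI flip: ennreal_mult)
    qed simp
  qed
  also have "\<dots> = ennreal ?k * (\<integral>\<^sup>+y. ?h y \<partial>M)"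
    by (rule nn_integral_cmult) measurable
  also have "\<dots> < \<infinity>"
    using finite_integral_at_infinity[of "v t - N"] by (simp add: ennreal_mult_less_top)
  finally have "integrable M (\<lambda>y. (indicator (E t N) y * (nrm (t / y) * g (t / y)))^2)"
    by (intro integrableI_bounded) auto
  then show ?thesis by (simp add: sq_int_def)
qed

text \<open>Finite sums of products; the inductive form turns each closure property into a short
  rule induction.\<close>

inductive sepf :: "('a \<Rightarrow> 'a \<Rightarrow> real) \<Rightarrow> bool" where
  sepf_prod: "sq_int g \<Longrightarrow> sq_int h \<Longrightarrow> sepf (\<lambda>y z. g y * h z)"
| sepf_add: "sepf k \<Longrightarrow> sepf k' \<Longrightarrow> sepf (\<lambda>y z. k y z + k' y z)"

lemma sepf_cmult: "sepf k \<Longrightarrow> sepf (\<lambda>y z. c * k y z)"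
proof (induction rule: sepf.induct)
  case (sepf_prod g h)
  then show ?case using sepf.sepf_prod[OF sq_int_cmult, of g h c] by (simp add: mult.assoc)
next
  case (sepf_add k k')
  then show ?case using sepf.sepf_add[of "\<lambda>y z. c * k y z"] by (simp add: distrib_left)
qed

lemma sepf_swap: "sepf k \<Longrightarrow> sepf (\<lambda>y z. k z y)"
proof (induction rule: sepf.induct)
  case (sepf_prod g h)
  then show ?case using sepf.sepf_prod[of h g] by (simp add: mult.commute)
next
  case (sepf_add k k')
  then show ?case using sepf.sepf_add[of "\<lambda>y z. k z y"] by simp
qed

lemma sepf_rectangle:
  "sepf k \<Longrightarrow> S \<in> sets M \<Longrightarrow> T \<in> sets M \<Longrightarrow> sepf (\<lambda>y z. indicator (S \<times> T) (y, z) * k y z)"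
proof (induction rule: sepf.induct)
  case (sepf_prod g h)
  then show ?case
    using sepf.sepf_prod[OF sq_int_indicator sq_int_indicator, of g S h T]
    by (simp add: indicator_times mult_ac)
next
  case (sepf_add k k')
  then show ?case
    using sepf.sepf_add[of "\<lambda>y z. indicator (S \<times> T) (y, z) * k y z"] by (simp add: distrib_left)
qed

definition sep :: "('a \<Rightarrow> 'a \<Rightarrow> real) \<Rightarrow> ('a \<times> 'a) set \<Rightarrow> bool" where
  "sep K X \<longleftrightarrow> sepf (\<lambda>y z. indicator X (y, z) * K y z)"

lemma sep_product:
  assumes "sq_int (\<lambda>y. indicator S y * g y)" "sq_int (\<lambda>z. indicator T z * h z)"
    and "\<And>y z. y \<in> S \<Longrightarrow> z \<in> T \<Longrightarrow> K y z = g y * h z"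
  shows "sep K (S \<times> T)"
proof -
  have "(\<lambda>y z. indicator (S \<times> T) (y, z) * K y z) = (\<lambda>y z. (indicator S y * g y) * (indicator T z * h z))"
    using assms(3) by (auto simp: fun_eq_iff indicator_def)
  then show ?thesis unfolding sep_def using sepf_prod[OF assms(1,2)] by simp
qed

lemma sep_empty: "sep K {}"
  using sepf_prod[OF sq_int_zero sq_int_zero] by (simp add: sep_def)

text \<open>Inclusion and exclusion: the overlap is counted twice and is removed by restricting the
  part on \<open>X\<close> to the rectangle, which preserves separability. Hence only the added set
  has to be a rectangle.\<close>

lemma sep_Un:
  assumes "sep K X" "sep K (S \<times> T)" "S \<in> sets M" "T \<in> sets M"
  shows "sep K (X \<union> S \<times> T)"
proof -
  let ?a = "\<lambda>y z. indicator X (y, z) * K y z" and ?b = "\<lambda>y z. indicator (S \<times> T) (y, z) * K y z"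
  have a: "sepf ?a" and b: "sepf ?b" using assms by (simp_all only: sep_def)
  have "sepf (\<lambda>y z. (?a y z + ?b y z) + (- 1) * (indicator (S \<times> T) (y, z) * ?a y z))"
    by (rule sepf_add[OF sepf_add[OF a b] sepf_cmult[OF sepf_rectangle[OF a assms(3,4)]]])
  moreover have "(\<lambda>y z. (?a y z + ?b y z) + (- 1) * (indicator (S \<times> T) (y, z) * ?a y z))
      = (\<lambda>y z. indicator (X \<union> S \<times> T) (y, z) * K y z)"
    by (auto simp: fun_eq_iff indicator_def)
  ultimately show ?thesis by (simp add: sep_def)
qed

lemma sep_subset:
  assumes "sep K X" "S \<in> sets M" "T \<in> sets M" "S \<times> T \<subseteq> X"
  shows "sep K (S \<times> T)"
proof -
  have "(\<lambda>y z. indicator (S \<times> T) (y, z) * (indicator X (y, z) * K y z))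
      = (\<lambda>y z. indicator (S \<times> T) (y, z) * K y z)"
    using assms(4) by (auto simp: fun_eq_iff indicator_def)
  then show ?thesis using sepf_rectangle[OF _ assms(2,3)] assms(1) by (fastforce simp: sep_def)
qed

lemma sep_swap:
  assumes "sep K (S \<times> T)" "\<And>y z. K y z = K z y"
  shows "sep K (T \<times> S)"
proof -
  have "(\<lambda>y z. indicator (S \<times> T) (z, y) * K z y) = (\<lambda>y z. indicator (T \<times> S) (y, z) * K y z)"
    using assms(2) by (auto simp: fun_eq_iff indicator_times)
  then show ?thesis using sepf_swap[of "\<lambda>y z. indicator (S \<times> T) (y, z) * K y z"] assms(1)
    by (simp add: sep_def)
qed

text \<open>Compactness of balls: a counterexample would yield, by repeated subdivision, a nested sequence
  of bad balls, whose common point has a good neighbourhood.\<close>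
lemma ball_compact_induct:
  assumes empty: "Q {}" and Un: "\<And>S T. Q S \<Longrightarrow> Q T \<Longrightarrow> Q (S \<union> T)"
    and loc: "\<And>a. \<exists>N. \<forall>k\<ge>N. Q (B a k)"
  shows "Q (B a k)"
proof (rule ccontr)
  assume bad: "\<not> Q (B a k)"
  have sub: "\<exists>b. b \<in> B a k \<and> \<not> Q (B b (k + 1))" if bad: "\<not> Q (B a k)" for a k
  proof (rule ccontr)
    assume good: "\<not> ?thesis"
    obtain R where R: "finite R" "B a k = (\<Union>r\<in>R. B (a + r) (k + 1))" using ball_split[of k] by metis
    have "Q (\<Union>r\<in>R'. B (a + r) (k + 1))" if "R' \<subseteq> R" for R'
      using finite_subset[OF that R(1)] that
    proof (induction R')
      case (insert r R')
      have "a + r \<in> B (a + r) (k + 1)" by simp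
      then have "a + r \<in> B a k" using R(2) insert.prems by blast
      then have "Q (B (a + r) (k + 1))" using good by blast
      then show ?case using insert Un by simp
    qed (simp add: empty)
    then show False using bad R(2) by auto
  qed
  define f where "f n b = (SOME c. c \<in> B b (k + int n) \<and> \<not> Q (B c (k + int n + 1)))" for n b
  define X where "X = rec_nat a f"
  have badX: "\<not> Q (B (X n) (k + int n))" for n
  proof (induction n)
    case 0
    then show ?case using bad by (simp add: X_def)
  next
    case (Suc n)
    show ?case using someI_ex[OF sub[OF Suc]] by (simp add: X_def f_def add_ac)
  qed
  have "X (Suc n) - X n \<in> P (k + int n)" for n
    using someI_ex[OF sub[OF badX[of n]]] by (simp add: X_def f_def)
  then obtain L where L: "\<And>n. L - X n \<in> P (k + int n)" using complete by blast
  obtain N where N: "\<forall>k\<ge>N. Q (B L k)" using loc by blast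
  have "B L (k + int n) = B (X n) (k + int n)" for n
    by (rule ball_eq) (use L in simp)
  then show False using N badX[of "nat (N - k)"] by (metis add.commute diff_le_eq int_nat_eq nat_le_iff nle_le of_nat_nat)
qed

text \<open>The tube lemma. The shrinking family \<open>S\<close> stands for the neighbourhoods of a
  point or of infinity, so one argument serves both.\<close>

lemma sep_tube:
  assumes S: "\<And>N. S N \<in> sets M" "\<And>N N'. N \<le> N' \<Longrightarrow> S N' \<subseteq> S N"
    and loc: "\<And>b. \<exists>N. sep K (S N \<times> B b N)"
  shows "\<exists>N. sep K (S N \<times> P k)"
proof -
  define Q where "Q T \<longleftrightarrow> T \<in> sets M \<and> (\<exists>N. sep K (S N \<times> T))" for T
  have "Q (B 0 k)"
  proof (rule ball_compact_induct)
    show "Q {}" by (simp add: Q_def sep_empty)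
    show "Q (T \<union> T')" if "Q T" "Q T'" for T T'
    proof -
      from that have m: "T \<in> sets M" "T' \<in> sets M" by (auto simp: Q_def)
      from that obtain N N' where N: "sep K (S N \<times> T)" "sep K (S N' \<times> T')" by (auto simp: Q_def)
      have "sep K (S (max N N') \<times> T)"
        by (rule sep_subset[OF N(1) S(1) m(1)]) (use S(2)[of N "max N N'"] in auto)
      moreover have "sep K (S (max N N') \<times> T')"
        by (rule sep_subset[OF N(2) S(1) m(2)]) (use S(2)[of N' "max N N'"] in auto)
      ultimately have "sep K (S (max N N') \<times> (T \<union> T'))"
        using sep_Un[OF _ _ S(1) m(2)] by (simp add: Sigma_Un_distrib2)
      then show ?thesis using m by (auto simp: Q_def)
    qed
    show "\<exists>N. \<forall>k\<ge>N. Q (B b k)" for b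
    proof -
      obtain N where N: "sep K (S N \<times> B b N)" using loc by blast
      have "Q (B b k)" if "k \<ge> N" for k
        using sep_subset[OF N S(1) ball_sets, of N b k] P_mono[OF that] by (auto simp: Q_def)
      then show ?thesis by blast
    qed
  qed
  then show ?thesis by (auto simp: Q_def)
qed

lemma sep_ball:
  assumes "\<And>a b. \<exists>N. sep K (B a N \<times> B b N)"
  shows "sep K (P j \<times> P k)"
proof -
  define Q where "Q S \<longleftrightarrow> S \<in> sets M \<and> sep K (S \<times> P k)" for S
  have "Q (B 0 j)"
  proof (rule ball_compact_induct)
    show "Q {}" by (simp add: Q_def sep_empty)
    show "Q (S \<union> S')" if "Q S" "Q S'" for S S'
      using that sep_Un[of K "S \<times> P k" S' "P k"] by (auto simp: Q_def Sigma_Un_distrib1)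
    show "\<exists>N. \<forall>k\<ge>N. Q (B a k)" for a
    proof -
      have "\<exists>N. sep K (B a N \<times> P k)"
        by (rule sep_tube) (use assms in \<open>auto intro: P_mono\<close>)
      then obtain N where N: "sep K (B a N \<times> P k)" by blast
      have "Q (B a k)" if "k \<ge> N" for k
        using sep_subset[OF N ball_sets P_sets, of a k] P_mono[OF that] by (auto simp: Q_def)
      then show ?thesis by blast
    qed
  qed
  then show ?thesis by (simp add: Q_def)
qed

text \<open>Gluing over the projective line squared: the rectangles at \<open>(\<infinity>, \<infinity>)\<close>, \<open>(\<infinity>, z)\<close>, \<open>(y, \<infinity>)\<close> are
  chosen first, what remains lies in a product of balls.\<close>
lemma sep_glue:
  assumes t: "t \<noteq> 0" and comm: "\<And>y z. K y z = K z y"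
    and fin: "\<And>a b. \<exists>N. sep K (B a N \<times> B b N)"
    and inf: "\<And>b. \<exists>N. sep K (E t N \<times> B b N)"
    and inf2: "\<exists>N. sep K (E t N \<times> E t N)"
  shows "sepf K"
proof -
  obtain N1 where N1: "sep K (E t N1 \<times> E t N1)" using inf2 by blast
  define k where "k = v t - N1 + 1"
  have "\<exists>N. sep K (E t N \<times> P k)"
    by (rule sep_tube[OF E_sets E_mono inf])
  then obtain N2 where N2: "sep K (E t N2 \<times> P k)" by blast
  \<comment> \<open>Makes \<open>P j\<close> contain both \<open>P k\<close> and the complement of
    \<open>E t N2\<close>, whatever the order of the two levels.\<close>
  define j where "j = min k (v t - N2 + 1)"
  have "sep K (((E t N1 \<times> E t N1 \<union> E t N2 \<times> P k) \<union> P k \<times> E t N2) \<union> P j \<times> P j)"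
    by (intro sep_Un N1 N2 sep_swap[OF N2 comm] sep_ball[OF fin] E_sets P_sets)
  moreover have "((E t N1 \<times> E t N1 \<union> E t N2 \<times> P k) \<union> P k \<times> E t N2) \<union> P j \<times> P j = UNIV"
  proof -
    have in_P: "y \<notin> E t N1 \<Longrightarrow> y \<in> P k" "y \<notin> E t N2 \<Longrightarrow> y \<in> P j" "y \<in> P k \<Longrightarrow> y \<in> P j" for y
      using compl_E[OF t, of y N1] compl_E[OF t, of y N2] P_mono[of j k y]
        P_mono[of j "v t - N2 + 1" y] by (auto simp: k_def j_def)
    have "(y, z) \<in> ((E t N1 \<times> E t N1 \<union> E t N2 \<times> P k) \<union> P k \<times> E t N2) \<union> P j \<times> P j" for y z
      using in_P[of y] in_P[of z] by blast
    then show ?thesis by auto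
  qed
  ultimately show ?thesis by (simp add: sep_def)
qed

section \<open>From separable kernels to finite rank\<close>

lemma finite_rank_sepf: "sepf k \<Longrightarrow> finite_rank_integral_op M k"
proof (induction rule: sepf.induct)
  case (sepf_prod g h)
  let ?g = "\<lambda>y. complex_of_real (g y)"
  have [measurable]: "g \<in> borel_measurable M" "h \<in> borel_measurable M"
    using sepf_prod by (auto simp: sq_int_def)
  have int: "integrable M (\<lambda>z. complex_of_real (h z) * \<psi> z)" if \<psi>: "square_integrable M \<psi>" for \<psi>
  proof (rule Bochner_Integration.integrable_bound)
    have [measurable]: "\<psi> \<in> borel_measurable M" using \<psi> by (simp add: square_integrable_def)
    show "integrable M (\<lambda>z. (h z)^2 + (cmod (\<psi> z))^2)"
      using sepf_prod \<psi> by (simp add: sq_int_def square_integrable_def)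
    show "(\<lambda>z. complex_of_real (h z) * \<psi> z) \<in> borel_measurable M" by measurable
    \<comment> \<open>Integrability of the product of two square integrable functions, from
      \<open>2 * \<bar>x\<bar> * y \<le> x^2 + y^2\<close>.\<close>
    have "\<bar>x\<bar> * y \<le> x^2 + y^2" for x y :: real
      using sum_squares_bound[of "\<bar>x\<bar>" y] zero_le_power2[of x] zero_le_power2[of y]
      unfolding power2_abs by linarith
    then show "AE z in M. norm (complex_of_real (h z) * \<psi> z) \<le> norm ((h z)^2 + (cmod (\<psi> z))^2)"
      by (auto simp: norm_mult)
  qed
  show ?case unfolding finite_rank_integral_op_def
  proof (intro exI[of _ "{?g}"] conjI allI impI ballI)
    show "square_integrable M f" if "f \<in> {?g}" for f
      using that sepf_prod by (auto simp: sq_int_def square_integrable_def)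
    fix \<psi> assume \<psi>: "square_integrable M \<psi>"
    have e: "complex_of_real (g y * h z) * \<psi> z = ?g y * (complex_of_real (h z) * \<psi> z)" for y z
      by simp
    show "AE y in M. integrable M (\<lambda>z. complex_of_real (g y * h z) * \<psi> z)"
      unfolding e using int[OF \<psi>] by (intro AE_I2 integrable_mult_right) auto
    show "\<exists>c. AE y in M. (\<integral>z. complex_of_real (g y * h z) * \<psi> z \<partial>M) = (\<Sum>f\<in>{?g}. c f * f y)"
      unfolding e by (intro exI[of _ "\<lambda>_. \<integral>z. complex_of_real (h z) * \<psi> z \<partial>M"] AE_I2)
        (simp add: mult.commute)
  qed simp
next
  case (sepf_add k k')
  obtain G where G: "finite G" "\<forall>g\<in>G. square_integrable M g"
    "\<And>\<psi>. square_integrable M \<psi> \<Longrightarrow> (AE y in M. integrable M (\<lambda>z. complex_of_real (k y z) * \<psi> z)) \<and>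
      (\<exists>c. AE y in M. (\<integral>z. complex_of_real (k y z) * \<psi> z \<partial>M) = (\<Sum>g\<in>G. c g * g y))"
    using sepf_add(3) unfolding finite_rank_integral_op_def by blast
  obtain G' where G': "finite G'" "\<forall>g\<in>G'. square_integrable M g"
    "\<And>\<psi>. square_integrable M \<psi> \<Longrightarrow> (AE y in M. integrable M (\<lambda>z. complex_of_real (k' y z) * \<psi> z)) \<and>
      (\<exists>c. AE y in M. (\<integral>z. complex_of_real (k' y z) * \<psi> z \<partial>M) = (\<Sum>g\<in>G'. c g * g y))"
    using sepf_add(4) unfolding finite_rank_integral_op_def by blast
  show ?case unfolding finite_rank_integral_op_def
  proof (intro exI[of _ "G \<union> G'"] conjI allI impI ballI)
    show "finite (G \<union> G')" using G G' by simp
    show "square_integrable M g" if "g \<in> G \<union> G'" for g using that G G' by blast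
    fix \<psi> assume \<psi>: "square_integrable M \<psi>"
    obtain c c' where c:
      "AE y in M. (\<integral>z. complex_of_real (k y z) * \<psi> z \<partial>M) = (\<Sum>g\<in>G. c g * g y)"
      "AE y in M. (\<integral>z. complex_of_real (k' y z) * \<psi> z \<partial>M) = (\<Sum>g\<in>G'. c' g * g y)"
      using G(3)[OF \<psi>] G'(3)[OF \<psi>] by blast
    have i: "AE y in M. integrable M (\<lambda>z. complex_of_real (k y z) * \<psi> z)"
      "AE y in M. integrable M (\<lambda>z. complex_of_real (k' y z) * \<psi> z)"
      using G(3)[OF \<psi>] G'(3)[OF \<psi>] by blast+
    show "AE y in M. integrable M (\<lambda>z. complex_of_real (k y z + k' y z) * \<psi> z)"
      using i by eventually_elim (simp add: distrib_right)
    \<comment> \<open>\<open>G\<close> and \<open>G'\<close> may overlap, so the coefficients are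
      extended by zero and added.\<close>
    let ?c = "\<lambda>g. (if g \<in> G then c g else 0) + (if g \<in> G' then c' g else 0)"
    have "AE y in M. (\<integral>z. complex_of_real (k y z + k' y z) * \<psi> z \<partial>M) = (\<Sum>g\<in>G \<union> G'. ?c g * g y)"
      using i c
    proof eventually_elim
      case (elim y)
      have "(\<integral>z. complex_of_real (k y z + k' y z) * \<psi> z \<partial>M)
          = (\<Sum>g\<in>G. c g * g y) + (\<Sum>g\<in>G'. c' g * g y)"
        using elim by (simp add: distrib_right)
      also have "(\<Sum>g\<in>G. c g * g y) = (\<Sum>g\<in>G \<union> G'. (if g \<in> G then c g else 0) * g y)"
        using G(1) G'(1) by (intro sum.mono_neutral_cong_left) auto
      also have "(\<Sum>g\<in>G'. c' g * g y) = (\<Sum>g\<in>G \<union> G'. (if g \<in> G' then c' g else 0) * g y)"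
        using G(1) G'(1) by (intro sum.mono_neutral_cong_left) auto
      finally show ?case by (simp add: distrib_right sum.distrib)
    qed
    then show "\<exists>c. AE y in M. (\<integral>z. complex_of_real (k y z + k' y z) * \<psi> z \<partial>M) = (\<Sum>g\<in>G \<union> G'. c g * g y)"
      by (rule exI[of _ ?c])
  qed
qed

section \<open>The Hecke kernel in the charts\<close>

lemma kernelK_eq_quad_int:
  assumes s: "s \<noteq> 0" and f: "\<And>x. s^2 * f_t t x y z = a^2 * x^2 + b * x + c"
  shows "kernelK v q M t x0 m y z = 2 * (nrm s * enn2real (quad_int x0 m a b c))"
proof -
  have [measurable]: "(\<lambda>x. w (a^2 * x^2 + b * x + c)) \<in> borel_measurable M"
    by (rule measurable_compose[OF quadratic_measurable w_measurable])
  \<comment> \<open>The square factor \<open>s^2\<close> keeps the square class and costs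
    \<open>nrm s\<close>; in the charts at infinity this becomes the half-density factor.\<close>
  have "w (f_t t x y z) = nrm s * w (a^2 * x^2 + b * x + c)" for x
    using w_mult[OF s, of "f_t t x y z"] s by (simp add: f)
  then have "(\<integral>\<^sup>+x. indicator (vball v q x0 m) x * ennreal (w (f_t t x y z)) \<partial>M)
      = (\<integral>\<^sup>+x. ennreal (nrm s) * (indicator (B x0 m) x * ennreal (w (a^2 * x^2 + b * x + c))) \<partial>M)"
    by (intro nn_integral_cong) (auto simp: indicator_def vball_eq simp flip: ennreal_mult)
  also have "\<dots> = ennreal (nrm s) * quad_int x0 m a b c"
    unfolding quad_int_def by (rule nn_integral_cmult) measurable
  finally show ?thesis
    by (simp add: kernelK_def wt_def enn2real_mult)
qed

lemma kernelK_commute: "kernelK v q M t x0 m y z = kernelK v q M t x0 m z y"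
  by (simp add: kernelK_def f_t_commute[of t _ y z])

lemma cubic_eq_0_iff: "cubic t y = 0 \<longleftrightarrow> y \<in> {0, 1, t}"
  by (auto simp: cubic_def)

definition chart_b :: "'a \<Rightarrow> 'a \<Rightarrow> 'a \<Rightarrow> 'a" where
  "chart_b t y z = 2 * (t - z * y) * (y - z) - 4 * (z - t) * (z - 1) * y"

definition chart_inf_b :: "'a \<Rightarrow> 'a \<Rightarrow> 'a \<Rightarrow> 'a" where
  "chart_inf_b t y z = 2 * (t - z * y) * (t * (y - z)) - 4 * t * (z - t) * (z - 1) * y"

lemma sixteen_nz: "(16::'a) \<noteq> 0"
proof -
  have "(16::'a) = 2 * 2 * 2 * 2" by simp
  then show ?thesis using two_nz by (metis mult_eq_0_iff)
qed

text \<open>At a pair of finite parabolic points \<open>f_t\<close> is a square: of a nonzero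
  constant if they coincide, otherwise of a linear polynomial whose root is the third point.\<close>

lemma f_t_nonzero:
  assumes t: "t \<noteq> 0" "t \<noteq> 1" and "cubic t x \<noteq> 0" and yz: "cubic t y = 0" "cubic t z = 0"
  shows "f_t t x y z \<noteq> 0"
proof -
  have x: "x \<noteq> 0" "x \<noteq> 1" "x \<noteq> t" using assms(3) by (auto simp: cubic_eq_0_iff)
  have sq: "f_t t x 0 0 = t^2" "f_t t x 1 1 = (t - 1)^2" "f_t t x t t = (t * (1 - t))^2"
    "f_t t x 0 1 = (t - x)^2" "f_t t x 0 t = (t * (1 - x))^2" "f_t t x 1 t = (x * (1 - t))^2"
    unfolding f_t_def by algebra+
  have "f_t t x 0 0 \<noteq> 0" "f_t t x 1 1 \<noteq> 0" "f_t t x t t \<noteq> 0"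
    "f_t t x 0 1 \<noteq> 0" "f_t t x 0 t \<noteq> 0" "f_t t x 1 t \<noteq> 0"
    unfolding sq using t x by auto
  then show ?thesis
    using yz f_t_commute[of t x 1 0] f_t_commute[of t x t 0] f_t_commute[of t x t 1]
    by (auto simp: cubic_eq_0_iff)
qed

text \<open>The leading coefficient vanishes only for \<open>y0 = z0\<close>, where the two cubic
  factors trivially vanish together.\<close>

lemma chart_finite:
  assumes t: "t \<noteq> 0" "t \<noteq> 1" and avoid: "\<And>x. x \<in> B x0 m \<Longrightarrow> cubic t x \<noteq> 0"
  obtains N g h where "tame y0 N g" "tame z0 N h" "\<And>y z. y \<in> B y0 N \<Longrightarrow> z \<in> B z0 N \<Longrightarrow>
      enn2real (quad_int x0 m (y - z) (chart_b t y z) ((t - z * y)^2)) = g y * h z"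
proof (rule quad_int_local_product[where a = "\<lambda>y z. y - z" and b = "chart_b t" and c = "\<lambda>y z. (t - z * y)^2"
      and m = m and ?x0.0 = x0 and ?y0.0 = y0 and ?z0.0 = z0, OF t sixteen_nz])
  show "(chart_b t y z)^2 - 4 * (y - z)^2 * (t - z * y)^2 = 16 * cubic t y * cubic t z" for y z
    unfolding chart_b_def cubic_def by algebra
  show "(y0 - z0)^2 * x^2 + chart_b t y0 z0 * x + (t - z0 * y0)^2 \<noteq> 0"
    if "x \<in> B x0 m" "cubic t y0 = 0" "cubic t z0 = 0" for x
    using f_t_nonzero[OF t avoid, of x y0 z0] that by (simp add: f_t_quadratic chart_b_def)
  show "vlim (\<lambda>u. chart_b t (fst u) (snd u)) (chart_b t y0 z0) (nb y0 \<times>\<^sub>F nb z0)"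
    unfolding chart_b_def by (intro vlim_intros)
  show "vlim (\<lambda>u. fst u - snd u) (y0 - z0) (nb y0 \<times>\<^sub>F nb z0)"
    "vlim (\<lambda>u. (t - snd u * fst u)^2) ((t - z0 * y0)^2) (nb y0 \<times>\<^sub>F nb z0)"
    by (intro vlim_intros)+
qed (auto intro: that)

text \<open>Here \<open>y = 0\<close> stands for infinity. The leading coefficient tends to
  \<open>t^2\<close>, so it does not degenerate, and the limit polynomial is
  \<open>(t * (x - z0))^2\<close>; its root \<open>z0\<close> is outside the ball if it is
  parabolic.\<close>

lemma chart_infinity:
  assumes t: "t \<noteq> 0" "t \<noteq> 1" and avoid: "\<And>x. x \<in> B x0 m \<Longrightarrow> cubic t x \<noteq> 0"
  obtains N g h where "tame 0 N g" "tame z0 N h" "\<And>y z. y \<in> B 0 N \<Longrightarrow> z \<in> B z0 N \<Longrightarrow>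
      enn2real (quad_int x0 m (t - z * y) (chart_inf_b t y z) ((t * (y - z))^2)) = g y * h z"
proof (rule quad_int_local_product[where a = "\<lambda>y z. t - z * y" and b = "chart_inf_b t"
      and c = "\<lambda>y z. (t * (y - z))^2" and m = m and ?x0.0 = x0 and ?y0.0 = 0 and ?z0.0 = z0, OF t])
  show "16 * t^2 \<noteq> 0" using t sixteen_nz by simp
  show "(chart_inf_b t y z)^2 - 4 * (t - z * y)^2 * (t * (y - z))^2 = 16 * t^2 * cubic t y * cubic t z" for y z
    unfolding chart_inf_b_def cubic_def by algebra
  show "(t - z0 * 0)^2 * x^2 + chart_inf_b t 0 z0 * x + (t * (0 - z0))^2 \<noteq> 0"
    if "x \<in> B x0 m" "cubic t z0 = 0" for x
  proof -
    have "x \<noteq> z0" using avoid[OF that(1)] that(2) by auto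
    moreover have "(t - z0 * 0)^2 * x^2 + chart_inf_b t 0 z0 * x + (t * (0 - z0))^2 = (t * (x - z0))^2"
      unfolding chart_inf_b_def by algebra
    ultimately show ?thesis using t by simp
  qed
  show "vlim (\<lambda>u. chart_inf_b t (fst u) (snd u)) (chart_inf_b t 0 z0) (nb 0 \<times>\<^sub>F nb z0)"
    unfolding chart_inf_b_def by (intro vlim_intros)
  show "vlim (\<lambda>u. t - snd u * fst u) (t - z0 * 0) (nb 0 \<times>\<^sub>F nb z0)"
    "vlim (\<lambda>u. (t * (fst u - snd u))^2) ((t * (0 - z0))^2) (nb 0 \<times>\<^sub>F nb z0)"
    by (intro vlim_intros)+
qed (use t in \<open>auto intro: that\<close>)

lemma sepf_kernelK:
  assumes t: "t \<noteq> 0" "t \<noteq> 1" and avoid: "\<And>x. x \<in> B x0 m \<Longrightarrow> cubic t x \<noteq> 0"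
  shows "sepf (kernelK v q M t x0 m)"
proof (rule sep_glue[OF t(1) kernelK_commute])
  let ?K = "kernelK v q M t x0 m"
  show "\<exists>N. sep ?K (B a N \<times> B b N)" for a b
  proof -
    obtain N g h where gh: "tame a N g" "tame b N h" "\<And>y z. y \<in> B a N \<Longrightarrow> z \<in> B b N \<Longrightarrow>
        enn2real (quad_int x0 m (y - z) (chart_b t y z) ((t - z * y)^2)) = g y * h z"
      by (rule chart_finite[OF t avoid]) blast+
    have K: "?K y z = 2 * (nrm 1 * enn2real (quad_int x0 m (y - z) (chart_b t y z) ((t - z * y)^2)))" for y z
      by (rule kernelK_eq_quad_int) (simp_all add: f_t_quadratic chart_b_def)
    have "sep ?K (B a N \<times> B b N)"
    proof (rule sep_product)
      show "sq_int (\<lambda>y. indicator (B a N) y * g y)" using gh(1) by (rule sq_int_tame)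
      show "sq_int (\<lambda>z. indicator (B b N) z * (2 * nrm 1 * h z))"
        using sq_int_cmult[OF sq_int_tame[OF gh(2)], of "2 * nrm 1"] by (simp add: mult_ac)
      show "?K y z = g y * (2 * nrm 1 * h z)" if "y \<in> B a N" "z \<in> B b N" for y z
        unfolding K gh(3)[OF that] by simp
    qed
    then show ?thesis by blast
  qed
  show "\<exists>N. sep ?K (E t N \<times> B b N)" for b
  proof -
    obtain N g h where gh: "tame 0 N g" "tame b N h" "\<And>y z. y \<in> B 0 N \<Longrightarrow> z \<in> B b N \<Longrightarrow>
        enn2real (quad_int x0 m (t - z * y) (chart_inf_b t y z) ((t * (y - z))^2)) = g y * h z"
      by (rule chart_infinity[OF t avoid]) blast+
    have K: "?K (t / y) z
        = 2 * (nrm y * enn2real (quad_int x0 m (t - z * y) (chart_inf_b t y z) ((t * (y - z))^2)))"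
      if "y \<noteq> 0" for y z
      using that f_t_infinity_quadratic[OF that]
      by (intro kernelK_eq_quad_int) (simp_all add: chart_inf_b_def)
    have "sep ?K (E t N \<times> B b N)"
    proof (rule sep_product)
      show "sq_int (\<lambda>y. indicator (E t N) y * (nrm (t / y) * g (t / y)))"
        using t(1) gh(1) by (rule sq_int_tame_infinity)
      show "sq_int (\<lambda>z. indicator (B b N) z * (2 * h z))"
        using sq_int_cmult[OF sq_int_tame[OF gh(2)], of 2] by (simp add: mult_ac)
      show "?K y z = (nrm (t / y) * g (t / y)) * (2 * h z)" if y: "y \<in> E t N" and z: "z \<in> B b N" for y z
      proof -
        have y': "t / y \<noteq> 0" "t / y \<in> B 0 N" using y t by (auto simp: E_def)
        \<comment> \<open>Each \<open>y\<close> in \<open>E t N\<close> is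
          \<open>t / (t / y)\<close>, so the chart formula is applied to the coordinate
          \<open>t / y\<close>.\<close>
        have "?K (t / (t / y)) z = 2 * (nrm (t / y) * (g (t / y) * h z))"
          unfolding K[OF y'(1)] gh(3)[OF y'(2) z] by simp
        then show ?thesis using t by simp
      qed
    qed
    then show ?thesis by blast
  qed
  \<comment> \<open>Inverting both variables multiplies \<open>f_t\<close> by a square, so the
    corner at infinity is governed by the finite chart at \<open>(0, 0)\<close>.\<close>
  show "\<exists>N. sep ?K (E t N \<times> E t N)"
  proof -
    obtain N g h where gh: "tame 0 N g" "tame 0 N h" "\<And>y z. y \<in> B 0 N \<Longrightarrow> z \<in> B 0 N \<Longrightarrow>
        enn2real (quad_int x0 m (y - z) (chart_b t y z) ((t - z * y)^2)) = g y * h z"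
      by (rule chart_finite[OF t avoid]) blast+
    have K: "?K (t / y) (t / z)
        = 2 * (nrm (y * z / t) * enn2real (quad_int x0 m (y - z) (chart_b t y z) ((t - z * y)^2)))"
      if yz: "y \<noteq> 0" "z \<noteq> 0" for y z
    proof (rule kernelK_eq_quad_int)
      show "y * z / t \<noteq> 0" using yz t by simp
      show "(y * z / t)^2 * f_t t x (t / y) (t / z) = (y - z)^2 * x^2 + chart_b t y z * x + (t - z * y)^2" for x
        using f_t_swap_infinity[OF yz, of t x] t
        by (simp add: power_divide f_t_quadratic[of t x y z] chart_b_def)
    qed
    have "sep ?K (E t N \<times> E t N)"
    proof (rule sep_product)
      show "sq_int (\<lambda>y. indicator (E t N) y * (nrm (t / y) * g (t / y)))"
        using t(1) gh(1) by (rule sq_int_tame_infinity)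
      show "sq_int (\<lambda>z. indicator (E t N) z * (2 / nrm t * (nrm (t / z) * h (t / z))))"
        using sq_int_cmult[OF sq_int_tame_infinity[OF t(1) gh(2)], of "2 / nrm t"] by (simp only: mult.left_commute)
      show "?K y z = (nrm (t / y) * g (t / y)) * (2 / nrm t * (nrm (t / z) * h (t / z)))"
        if y: "y \<in> E t N" and z: "z \<in> E t N" for y z
      proof -
        have y': "t / y \<noteq> 0" "t / y \<in> B 0 N" and z': "t / z \<noteq> 0" "t / z \<in> B 0 N"
          using y z t by (auto simp: E_def)
        have "?K (t / (t / y)) (t / (t / z)) = 2 * (nrm ((t / y) * (t / z) / t) * (g (t / y) * h (t / z)))"
          unfolding K[OF y'(1) z'(1)] gh(3)[OF y'(2) z'(2)] by simp
        also have "nrm ((t / y) * (t / z) / t) = nrm (t / y) * nrm (t / z) / nrm t"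
          by (simp only: nrm_mult nrm_divide)
        finally show ?thesis using t by simp
      qed
    qed
    then show ?thesis by blast
  qed
qed

end

theorem theorem6p1:
  fixes v :: "'a::field \<Rightarrow> int" and q p :: nat and M :: "'a measure" and t x0 :: 'a
  assumes "nonarch_local_field v q p" and "p > 2"
    and "haar_measure v q M"
    and "t \<noteq> 0" and "t \<noteq> 1"
    and "x0 \<noteq> 0" and "x0 \<noteq> 1" and "x0 \<noteq> t"
  shows "\<exists>m0::int. \<forall>m\<ge>m0. finite_rank_integral_op M (kernelK v q M t x0 m)"
proof -
  interpret local_field_haar v q p M
    using assms(1-3) by unfold_locales
  \<comment> \<open>The summand 1 makes \<open>m\<close> strictly larger than the valuations of
    \<open>x0\<close>, \<open>x0 - 1\<close> and \<open>x0 - t\<close>, so none of 0, 1,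
    \<open>t\<close> lies in the ball.\<close>
  define m0 where "m0 = max (v x0) (max (v (x0 - 1)) (v (x0 - t))) + 1"
  have "finite_rank_integral_op M (kernelK v q M t x0 m)" if m: "m \<ge> m0" for m
  proof (rule finite_rank_sepf, rule sepf_kernelK)
    show "cubic t x \<noteq> 0" if x: "x \<in> {x. x - x0 \<in> vid v m}" for x
    proof
      assume "cubic t x = 0"
      then have "x \<in> {0, 1, t}" by (simp only: cubic_eq_0_iff)
      moreover have "x0 - x \<in> vid v m" using x P_diff_commute by simp
      ultimately show False using m assms(6-8) by (auto simp: m0_def vid_def)
    qed
  qed (use assms in simp_all)
  then show ?thesis by blast
qed

end
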